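(* The peak functions $\theta_{S,u}$ indexed by admissible pairs $(S,u)$ form a basis of $\mathcal O^{\boldsymbol\infty}$. Moreover, if $\mathbf I$ is a vector composition all of whose columns have odd weight and $u=\mathrm{cw}(\mathbf I)$, then \[\eta_{\mathbf I}=\sum_{S\subseteq\mathrm{Pk}(\widetilde{\mathbf I})}(-1)^{|S|}\theta_{S,u},\] and for every admissible pair $(S,u)$, \[\theta_{S,u}=\sum_{T\subseteq S}(-1)^{|T|}\eta_{\mathrm{odd}(\mathbf I_{T,u})}.\]
   Context: Fix $\ell\ge1$; $|\mathbf n|=\sum n_i$; $\mathbf e_c$ coordinate vectors. Vector composition: sequence $\mathbf I=(\mathbf i_1,\dots,\mathbf i_m)$ of nonzero elements of $\mathbb N^\ell$; $\mathrm{len}(\mathbf I)=m$; $\Sigma\mathbf I=\sum\mathbf i_r$. $\mathbf J\trianglelefteq\mathbf I$: $\mathbf J$ obtained from $\mathbf I$ by adding together groups of consecutive columns. $D(\mathbf I)=\{|\mathbf i_1|,\dots,|\mathbf i_1|+\dots+|\mathbf i_{m-1}|\}$, $D+1=\{s+1:s\in D\}$, $\mathrm{Pk}(\mathbf I)=\{|\mathbf i_1|+\dots+|\mathbf i_r|:1\le r\le m-1,\ |\mathbf i_r|\ge2\}$. Coloring word $\mathrm{cw}(\mathbf I)$: read columns left to right, writing in column $\mathbf i_r$ the color $c$ repeated ($c$-th entry) times for $c=0,\dots,\ell-1$. For $u=u_1\cdots u_n\in\{0,\dots,\ell-1\}^n$, $\mathbf E_u=(\mathbf e_{u_1},\dots,\mathbf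 e_{u_n})$. If the last column of $\mathbf I$ has odd weight, $\mathbf I=\mathbf I_1\cdots\mathbf I_p$ uniquely with each $\mathbf I_j$ having odd-weight last column and even-weight other columns, and $\mathrm{odd}(\mathbf I)=(\Sigma\mathbf I_1,\dots,\Sigma\mathbf I_p)$. For $\mathbf I$ with all columns of odd weight, $\widetilde{\mathbf I}$ is the vector composition with the same coloring word obtained by replacing each column by a vector composition of it whose columns have weight $2$ except the last, of weight $1$. A peak subset of $[n]$ is $S\subseteq\{2,\dots,n-1\}$ with $i\in S\Rightarrow i-1\notin S$. For such $S$ and $u$ of length $n$, $\mathbf I_{S,u}$ is the unique vector composition with all columns of weight $1$ or $2$, coloring word $u$ and $\mathrm{Pk}(\mathbf I_{S,u})=S$; $(S,u)$ is admissible if $\mathrm{cw}(\mathrm{odd}(\mathbf I_{S,u}))=u$. $\mathrm{QSym}^{(\ell)}$: $\mathbb Q$-span of $M_{\mathbf I}=\sum_{j_1<\dots<j_m}\mathbf x_{j_1}^{\mathbf i_1}\cdots\mathbf x_{j_m}^{\mathbf i_m}$ in commuting variables $x_j^{(i)}$ ($\mathbf x_j^{\mathbf n}=\prod_i(x_j^{(i)})^{n_i}$), graded Hopf algebra with deconcatenation coproduct; $\eta_{\mathbf I}=\sum_{\mathbf J\trianglelefteq\mathbf I}2^{\mathrm{len}(\mathbf J)}M_{\mathbf J}$; $\theta_{S,u}=\sum_{\mathbf J\trianglelefteq\mathbf E_u,\ S\subseteq D(\mathbf J)\cup(D(\mathbf J)+1)}2^{\mathrm{len}(\mathbf J)}M_{\mathbf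 J}$. $\zeta_{\mathcal Q}(M_{\mathbf I})=1$ if $\mathrm{len}(\mathbf I)\le1$, else $0$; $\bar\zeta_{\mathcal Q}(h)=(-1)^{|\mathbf n|}\zeta_{\mathcal Q}(h)$ on degree $\mathbf n$; $\mathcal O^{\boldsymbol\infty}$ is the largest graded subcoalgebra $C$ of $\mathrm{QSym}^{(\ell)}$ with $\bar\zeta_{\mathcal Q}(h)=\zeta_{\mathcal Q}^{-1}(h)$ for all $h\in C$ ($\zeta_{\mathcal Q}^{-1}$ the convolution inverse).
   Formalization: I_{S,u} as described need not be unique (u=00, S=∅: both (e_0,e_0) and (2e_0)) or exist (u=100, S={2}); here its last column is required to have odd weight, so that odd(I_{S,u}) is defined, and existence of I_{S,u} is part of admissibility. *)

theory Defs
  imports Complex_Main "HOL-Library.Poly_Mapping" "HOL-Library.Function_Algebras"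
begin

section \<open>Vector compositions\<close>

text \<open>
  An element of \<open>\<nat>\<^sup>l\<close> is a finitely supported map from colors to \<open>\<nat>\<close> whose support lies in
  \<open>{0,...,l-1}\<close>. The number \<open>l\<close> of colors enters only through the carriers.
\<close>

type_synonym cvec = "nat \<Rightarrow>\<^sub>0 nat"
type_synonym vcomp = "cvec list"
type_synonym color_word = "nat list"

definition wt :: "cvec \<Rightarrow> nat" where
  "wt v = (\<Sum>c\<in>Poly_Mapping.keys v. Poly_Mapping.lookup v c)"

definition vcomps :: "nat \<Rightarrow> vcomp set" where
  "vcomps l = {I. \<forall>i\<in>set I. i \<noteq> 0 \<and> Poly_Mapping.keys i \<subseteq> {..<l}}"

definition coarsens :: "vcomp \<Rightarrow> vcomp \<Rightarrow> bool"  (infix \<open>\<unlhd>\<close> 50) where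
  "J \<unlhd> I \<longleftrightarrow> (\<exists>Bs. concat Bs = I \<and> [] \<notin> set Bs \<and> J = map sum_list Bs)"

definition partial_wt :: "vcomp \<Rightarrow> nat \<Rightarrow> nat" where
  "partial_wt I r = (\<Sum>i\<leftarrow>take r I. wt i)"

definition D :: "vcomp \<Rightarrow> nat set" where
  "D I = {partial_wt I r |r. 1 \<le> r \<and> r < length I}"

text \<open>The \<open>r\<close>-th column, counted from \<open>1\<close>, is \<open>I ! (r - 1)\<close>.\<close>

definition Pk :: "vcomp \<Rightarrow> nat set" where
  "Pk I = {partial_wt I r |r. 1 \<le> r \<and> r < length I \<and> wt (I ! (r - 1)) \<ge> 2}"

definition cw :: "vcomp \<Rightarrow> color_word" where
  "cw I = concat (map (\<lambda>i. concat (map (\<lambda>c. replicate (Poly_Mapping.lookup i c) c)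
                             (sorted_list_of_set (Poly_Mapping.keys i)))) I)"

definition E :: "color_word \<Rightarrow> vcomp" where
  "E u = map (\<lambda>c. Poly_Mapping.single c 1) u"

definition odd_blocks :: "vcomp \<Rightarrow> vcomp list \<Rightarrow> bool" where
  "odd_blocks I Bs \<longleftrightarrow> concat Bs = I \<and>
     (\<forall>B\<in>set Bs. B \<noteq> [] \<and> odd (wt (last B)) \<and> (\<forall>i\<in>set (butlast B). even (wt i)))"

text \<open>Meaningful if the last column has odd weight; for the empty composition the value is empty.\<close>

definition odd_comp :: "vcomp \<Rightarrow> vcomp" where
  "odd_comp I = map sum_list (THE Bs. odd_blocks I Bs)"

text \<open>\<open>is_tilde I K\<close>: the composition \<open>K\<close> is the one denoted by \<open>I\<close> with a tilde.\<close>

definition is_tilde :: "vcomp \<Rightarrow> vcomp \<Rightarrow> bool" where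
  "is_tilde I K \<longleftrightarrow> cw K = cw I \<and>
     (\<exists>Bs. K = concat Bs \<and>
        list_all2 (\<lambda>i B. sum_list B = i \<and> B \<noteq> [] \<and>
                     (\<forall>b\<in>set (butlast B). wt b = 2) \<and> wt (last B) = 1) I Bs)"

definition tilde :: "vcomp \<Rightarrow> vcomp" where
  "tilde I = (THE K. is_tilde I K)"

definition peak_subset :: "nat \<Rightarrow> nat set \<Rightarrow> bool" where
  "peak_subset n S \<longleftrightarrow> S \<subseteq> {2..n - 1} \<and> (\<forall>i\<in>S. i - 1 \<notin> S)"

text \<open>
  \<open>Pk\<close> does not see the weight of the last column. Since \<open>odd_comp\<close> is to be applied to
  \<open>I\<^bsub>S,u\<^esub>\<close>, its last column has odd weight; with this requirement there is at most one such
  composition. There is none if the letters of \<open>u\<close> in positions \<open>s - 1\<close>, \<open>s\<close> decrease for some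
  \<open>s \<in> S\<close>, because a coloring word is weakly increasing inside each column; such a pair
  \<open>(S, u)\<close> is not admissible.
\<close>

definition is_peak_comp :: "nat set \<Rightarrow> color_word \<Rightarrow> vcomp \<Rightarrow> bool" where
  "is_peak_comp S u I \<longleftrightarrow> (\<forall>i\<in>set I. wt i = 1 \<or> wt i = 2) \<and> cw I = u \<and> Pk I = S \<and>
     (I \<noteq> [] \<longrightarrow> odd (wt (last I)))"

definition peak_comp :: "nat set \<Rightarrow> color_word \<Rightarrow> vcomp" where
  "peak_comp S u = (THE I. is_peak_comp S u I)"

definition admissible :: "nat \<Rightarrow> (nat set \<times> color_word) set" where
  "admissible l = {(S, u). set u \<subseteq> {..<l} \<and> peak_subset (length u) S \<and>
     (\<exists>I. is_peak_comp S u I) \<and> cw (odd_comp (peak_comp S u)) = u}"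


section \<open>Quasisymmetric functions in \<open>l\<close> sets of variables\<close>

text \<open>
  A monomial in the variables \<open>x\<^sub>j\<^sup>(\<^sup>c\<^sup>)\<close> is given by the exponent vector of \<open>\<^bold>x\<^sub>j\<close> for every \<open>j\<close>,
  so that \<open>\<^bold>x\<^sub>j\<^sup>n\<close> is \<open>Poly_Mapping.single j n\<close> and \<open>+\<close> multiplies monomials. The indices \<open>j\<close>
  start from \<open>0\<close>. Formal power series are families of coefficients; addition of series is the
  pointwise one of \<^theory>\<open>HOL-Library.Function_Algebras\<close>, whose pointwise product is not used.
\<close>

type_synonym xmonom = "nat \<Rightarrow>\<^sub>0 cvec"
type_synonym series = "xmonom \<Rightarrow> rat"

definition scl :: "rat \<Rightarrow> ('a \<Rightarrow> rat) \<Rightarrow> 'a \<Rightarrow> rat" where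
  "scl a f = (\<lambda>m. a * f m)"

global_interpretation fs: vector_space "scl :: rat \<Rightarrow> ('a \<Rightarrow> rat) \<Rightarrow> 'a \<Rightarrow> rat"
  by unfold_locales (auto simp: scl_def fun_eq_iff algebra_simps)

definition xmono :: "nat list \<Rightarrow> vcomp \<Rightarrow> xmonom" where
  "xmono js I = (\<Sum>r<length I. Poly_Mapping.single (js ! r) (I ! r))"

definition M :: "vcomp \<Rightarrow> series" where
  "M I = (\<lambda>m. of_nat (card {js. length js = length I \<and> sorted_wrt (<) js \<and> xmono js I = m}))"

definition QSym :: "nat \<Rightarrow> series set" where
  "QSym l = fs.span (M ` vcomps l)"

definition QSym_deg :: "nat \<Rightarrow> cvec \<Rightarrow> series set" where
  "QSym_deg l n = fs.span (M ` {I \<in> vcomps l. sum_list I = n})"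

definition eta :: "vcomp \<Rightarrow> series" where
  "eta I = (\<Sum>J | J \<unlhd> I. scl (2 ^ length J) (M J))"

definition theta :: "nat set \<Rightarrow> color_word \<Rightarrow> series" where
  "theta S u = (\<Sum>J | J \<unlhd> E u \<and> S \<subseteq> D J \<union> Suc ` D J. scl (2 ^ length J) (M J))"


section \<open>The coalgebra structure\<close>

text \<open>
  The coefficient of \<open>M I\<close> in a quasisymmetric function is its coefficient at the monomial
  \<open>\<^bold>x\<^sub>0\<^bsup>i\<^sub>1\<^esup> \<^bold>x\<^sub>1\<^bsup>i\<^sub>2\<^esup> \<dots>\<close>; see lemma \<open>M_coeff_M\<close> below.
\<close>

definition M_coeff :: "series \<Rightarrow> vcomp \<Rightarrow> rat" where
  "M_coeff h I = h (xmono [0..<length I] I)"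

definition M_supp :: "series \<Rightarrow> vcomp set" where
  "M_supp h = {I. 0 \<notin> set I \<and> M_coeff h I \<noteq> 0}"

text \<open>The linear functional on quasisymmetric functions with value \<open>\<phi> I\<close> on \<open>M I\<close>.\<close>

definition M_functional :: "(vcomp \<Rightarrow> rat) \<Rightarrow> series \<Rightarrow> rat" where
  "M_functional \<phi> h = (\<Sum>I\<in>M_supp h. M_coeff h I * \<phi> I)"

text \<open>
  Tensors are realised as power series in two independent sets of variables; \<open>f \<otimes> g\<close> becomes the
  product \<open>f(x) g(y)\<close>, which embeds the algebraic tensor product.
\<close>

definition tensor :: "series \<Rightarrow> series \<Rightarrow> xmonom \<times> xmonom \<Rightarrow> rat" where
  "tensor f g = (\<lambda>(p, q). f p * g q)"

definition tensor_square :: "series set \<Rightarrow> (xmonom \<times> xmonom \<Rightarrow> rat) set" where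
  "tensor_square C = fs.span {tensor f g |f g. f \<in> C \<and> g \<in> C}"

definition coprod :: "series \<Rightarrow> xmonom \<times> xmonom \<Rightarrow> rat" where
  "coprod h = (\<Sum>I\<in>M_supp h. scl (M_coeff h I)
                 (\<Sum>k\<le>length I. tensor (M (take k I)) (M (drop k I))))"

definition counit :: "series \<Rightarrow> rat" where
  "counit = M_functional (\<lambda>I. if I = [] then 1 else 0)"

text \<open>The convolution \<open>(f \<otimes> g) \<circ> coprod\<close> of linear functionals.\<close>

definition conv :: "(series \<Rightarrow> rat) \<Rightarrow> (series \<Rightarrow> rat) \<Rightarrow> series \<Rightarrow> rat" where
  "conv f g = M_functional (\<lambda>I. \<Sum>k\<le>length I. f (M (take k I)) * g (M (drop k I)))"

definition linear_on_QSym :: "nat \<Rightarrow> (series \<Rightarrow> rat) \<Rightarrow> bool" where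
  "linear_on_QSym l f \<longleftrightarrow>
     (\<forall>h\<in>QSym l. \<forall>k\<in>QSym l. f (h + k) = f h + f k) \<and>
     (\<forall>a. \<forall>h\<in>QSym l. f (scl a h) = a * f h)"

definition conv_inverse :: "nat \<Rightarrow> (series \<Rightarrow> rat) \<Rightarrow> (series \<Rightarrow> rat) \<Rightarrow> bool" where
  "conv_inverse l f g \<longleftrightarrow> linear_on_QSym l g \<and>
     (\<forall>h\<in>QSym l. conv f g h = counit h \<and> conv g f h = counit h)"

definition zetaQ :: "series \<Rightarrow> rat" where
  "zetaQ = M_functional (\<lambda>I. if length I \<le> 1 then 1 else 0)"

text \<open>The values of \<open>zetaQ_inv l\<close> on \<open>QSym l\<close> do not depend on the choice.\<close>

definition zetaQ_inv :: "nat \<Rightarrow> series \<Rightarrow> rat" where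
  "zetaQ_inv l = (SOME g. conv_inverse l zetaQ g)"

definition deg_part :: "cvec \<Rightarrow> series \<Rightarrow> series" where
  "deg_part n h = (\<Sum>I\<in>{I \<in> M_supp h. sum_list I = n}. scl (M_coeff h I) (M I))"

definition zetaQ_bar :: "series \<Rightarrow> rat" where
  "zetaQ_bar h = (\<Sum>n\<in>sum_list ` M_supp h. (- 1) ^ wt n * zetaQ (deg_part n h))"

definition graded_subcoalgebra :: "nat \<Rightarrow> series set \<Rightarrow> bool" where
  "graded_subcoalgebra l C \<longleftrightarrow>
     fs.subspace C \<and> C \<subseteq> QSym l \<and>
     C = fs.span (\<Union>n. C \<inter> QSym_deg l n) \<and>
     coprod ` C \<subseteq> tensor_square C"

definition O_infty :: "nat \<Rightarrow> series set" where
  "O_infty l = (GREATEST C. graded_subcoalgebra l C \<and> (\<forall>h\<in>C. zetaQ_bar h = zetaQ_inv l h))"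


subsection \<open>Values on the monomial basis\<close>

lemma lookup_xmono:
  assumes "sorted_wrt (<) js" "length js = length I" "r < length I"
  shows "Poly_Mapping.lookup (xmono js I) (js ! r) = I ! r"
proof -
  have d: "distinct js"
    using assms(1) by (simp add: strict_sorted_iff)
  have "Poly_Mapping.lookup (xmono js I) (js ! r) =
        (\<Sum>s<length I. if s = r then I ! s else 0)"
    unfolding xmono_def lookup_sum
    using d assms by (intro sum.cong) (auto simp: lookup_single when_def nth_eq_iff_index_eq)
  then show ?thesis
    using assms by simp
qed

lemma keys_xmono:
  assumes "sorted_wrt (<) js" "length js = length I" "0 \<notin> set I"
  shows "Poly_Mapping.keys (xmono js I) = set js"
proof
  show "Poly_Mapping.keys (xmono js I) \<subseteq> set js"
  proof
    fix j assume j: "j \<in> Poly_Mapping.keys (xmono js I)"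
    show "j \<in> set js"
    proof (rule ccontr)
      assume "j \<notin> set js"
      then have "Poly_Mapping.lookup (xmono js I) j = 0"
        unfolding xmono_def lookup_sum using assms(2)
        by (intro sum.neutral) (auto simp: lookup_single when_def)
      with j show False
        by (simp add: in_keys_iff)
    qed
  qed
  show "set js \<subseteq> Poly_Mapping.keys (xmono js I)"
  proof
    fix j assume "j \<in> set js"
    then obtain r where "r < length js" "j = js ! r"
      by (auto simp: in_set_conv_nth)
    with lookup_xmono[of js I r] assms show "j \<in> Poly_Mapping.keys (xmono js I)"
      by (auto simp: in_keys_iff) (metis nth_mem)
  qed
qed

lemma xmono_inject:
  assumes "sorted_wrt (<) js" "length js = length I" "0 \<notin> set I"
    and "sorted_wrt (<) ks" "length ks = length J" "0 \<notin> set J"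
  shows "xmono js I = xmono ks J \<longleftrightarrow> js = ks \<and> I = J"
proof
  assume eq: "xmono js I = xmono ks J"
  then have "set js = set ks"
    using keys_xmono assms by metis
  then have js: "js = ks"
    using assms by (intro strict_sorted_equal) auto
  moreover have "I = J"
    using js eq assms lookup_xmono by (intro nth_equalityI) metis+
  ultimately show "js = ks \<and> I = J" ..
qed simp

lemma M_coeff_M:
  assumes "0 \<notin> set I" "0 \<notin> set J"
  shows "M_coeff (M I) J = (if I = J then 1 else 0)"
proof -
  have "{js. length js = length I \<and> sorted_wrt (<) js \<and> xmono js I = xmono [0..<length J] J} =
        (if I = J then {[0..<length J]} else {})"
    using xmono_inject[of _ I "[0..<length J]" J] assms by auto
  then show ?thesis
    by (simp add: M_coeff_def M_def)
qed

lemma M_supp_M: "0 \<notin> set I \<Longrightarrow> M_supp (M I) = {I}"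
  by (auto simp: M_supp_def M_coeff_M split: if_splits)

lemma coprod_M:
  "0 \<notin> set I \<Longrightarrow> coprod (M I) = (\<Sum>k\<le>length I. tensor (M (take k I)) (M (drop k I)))"
  by (simp add: coprod_def M_supp_M M_coeff_M)

lemma M_functional_M: "0 \<notin> set I \<Longrightarrow> M_functional \<phi> (M I) = \<phi> I"
  by (simp add: M_functional_def M_supp_M M_coeff_M)

end

theory Submission
  imports Defs "HOL-Library.Multiset"
begin

text \<open>
  A composition \<open>K\<close> with odd columns is encoded by the pair of \<open>Pk(\<close>\<open>K\<close>-tilde\<open>)\<close> and \<open>cw(K)\<close>; the
  admissible pairs are exactly the pairs that arise, and \<open>(S, u) \<mapsto> odd(I\<^bsub>S,u\<^esub>)\<close> is the inverse
  encoding. A coarsening \<open>J\<close> of \<open>E\<^sub>u\<close> is a coarsening of \<open>K\<close> if and only if no peak of \<open>K\<close>-tilde lies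
  in \<open>D(J) \<union> (D(J) + 1)\<close>, so both expansions are instances of inclusion-exclusion.

  It remains to see that the \<open>\<eta>\<^sub>K\<close> with odd columns form a basis of the coalgebra. They span a
  graded subcoalgebra on which the two functionals agree. Conversely, contracting the coproduct of
  an element \<open>h\<close> of any such subcoalgebra shows that, for all \<open>A\<close>, \<open>B\<close> and \<open>m \<noteq> 0\<close>, the sum of
  \<open>(-1)\<^bsup>len J\<^esup> h(A J B)\<close> over the compositions \<open>J\<close> of \<open>m\<close> equals \<open>(-1)\<^bsup>|m|\<^esup> h(A m B)\<close>, where \<open>h(I)\<close>
  is the coefficient of \<open>M\<^sub>I\<close>. For even \<open>|m|\<close> this determines \<open>h\<close> by its values at compositions with
  odd columns, on which the \<open>\<eta>\<^sub>K\<close> are triangular.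
\<close>


section \<open>Alternating sums over subsets\<close>

lemma sum_Pow_minus_one_power_card:
  assumes "finite X"
  shows "(\<Sum>T\<in>Pow X. (- 1) ^ card T) = (if X = {} then 1 else (0 :: 'a :: ring_1))"
proof (cases "X = {}")
  case False
  then have "card {T. T \<subseteq> X \<and> even (card T)} = card {T. T \<subseteq> X \<and> odd (card T)}"
    using card_subsupersets_even_odd[OF assms, of "{}"] by auto
  with False show ?thesis
    using assms by (simp add: sum_alternating_cancels)
qed simp

lemma sum_disjoint_eq_sum_Pow:
  fixes f :: "'j \<Rightarrow> 'a :: ring_1"
  assumes "finite C" "finite S"
  shows "(\<Sum>J | J \<in> C \<and> S \<inter> G J = {}. f J) =
    (\<Sum>T\<in>Pow S. (- 1) ^ card T * (\<Sum>J | J \<in> C \<and> T \<subseteq> G J. f J))"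
proof -
  have "(\<Sum>T\<in>Pow S. (- 1) ^ card T * (\<Sum>J | J \<in> C \<and> T \<subseteq> G J. f J)) =
      (\<Sum>T\<in>Pow S. \<Sum>J\<in>C. if T \<subseteq> G J then (- 1) ^ card T * f J else 0)"
    using assms(1) by (simp add: sum_distrib_left sum.inter_filter if_distrib[of "\<lambda>x. _ * x"]
        cong: if_cong)
  also have "\<dots> = (\<Sum>J\<in>C. \<Sum>T\<in>Pow S. if T \<subseteq> G J then (- 1) ^ card T * f J else 0)"
    by (rule sum.swap)
  also have "\<dots> = (\<Sum>J\<in>C. (\<Sum>T\<in>Pow (S \<inter> G J). (- 1) ^ card T) * f J)"
  proof (intro sum.cong refl)
    fix J
    have "{T \<in> Pow S. T \<subseteq> G J} = Pow (S \<inter> G J)"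
      by auto
    then show "(\<Sum>T\<in>Pow S. if T \<subseteq> G J then (- 1) ^ card T * f J else 0) =
        (\<Sum>T\<in>Pow (S \<inter> G J). (- 1) ^ card T) * f J"
      using assms(2) by (simp add: sum.inter_filter[symmetric] sum_distrib_right)
  qed
  also have "\<dots> = (\<Sum>J | J \<in> C \<and> S \<inter> G J = {}. f J)"
    using assms by (simp add: sum_Pow_minus_one_power_card if_distrib[of "\<lambda>x. x * _"] sum.inter_filter
        cong: if_cong del: Pow_Int_eq)
  finally show ?thesis ..
qed


section \<open>Triangular families of vectors\<close>

locale triangular_family = vector_space scale
  for scale :: "'a :: field \<Rightarrow> 'b :: ab_group_add \<Rightarrow> 'b" (infixr \<open>*s\<close> 75) +
  fixes A :: "'i set" and f :: "'i \<Rightarrow> 'b" and coord :: "'i \<Rightarrow> 'b \<Rightarrow> 'a" and rank :: "'i \<Rightarrow> nat"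
  assumes linear_coord: "i \<in> A \<Longrightarrow> Vector_Spaces.linear (*s) (*) (coord i)"
    and diagonal: "i \<in> A \<Longrightarrow> coord i (f i) \<noteq> 0"
    and triangular: "i \<in> A \<Longrightarrow> j \<in> A \<Longrightarrow> coord i (f j) \<noteq> 0 \<Longrightarrow> i = j \<or> rank i < rank j"
begin

lemma
  assumes "i \<in> A"
  shows coord_0: "coord i 0 = 0"
    and coord_add: "coord i (x + y) = coord i x + coord i y"
    and coord_diff: "coord i (x - y) = coord i x - coord i y"
    and coord_combination: "coord i (\<Sum>j\<in>F. c j *s f j) = (\<Sum>j\<in>F. c j * coord i (f j))"
proof -
  interpret Vector_Spaces.linear "(*s)" "(*)" "coord i"
    using assms by (rule linear_coord)
  show "coord i 0 = 0" "coord i (x + y) = coord i x + coord i y"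
      "coord i (x - y) = coord i x - coord i y"
      "coord i (\<Sum>j\<in>F. c j *s f j) = (\<Sum>j\<in>F. c j * coord i (f j))"
    by (simp_all add: zero add diff sum scale)
qed

lemma coord_combination_top_rank:
  assumes "finite F" "F \<subseteq> A" "i \<in> A" "\<And>j. j \<in> F \<Longrightarrow> c j \<noteq> 0 \<Longrightarrow> rank j \<le> rank i"
  shows "coord i (\<Sum>j\<in>F. c j *s f j) = (if i \<in> F then c i * coord i (f i) else 0)"
proof -
  have "c j * coord i (f j) = (if j = i then c i * coord i (f i) else 0)" if "j \<in> F" for j
  proof -
    have "c j = 0 \<or> j = i \<or> coord i (f j) = 0"
      using triangular[of i j] assms(2-4) that by (metis linorder_not_le subsetD)
    then show ?thesis
      by auto
  qed
  then have "coord i (\<Sum>j\<in>F. c j *s f j) = (\<Sum>j\<in>F. if j = i then c i * coord i (f i) else 0)"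
    unfolding coord_combination[OF assms(3)] by (rule sum.cong[OF refl])
  then show ?thesis
    using assms(1) by simp
qed

lemma inj_on_family: "inj_on f A"
proof (rule inj_onI)
  fix i j assume "i \<in> A" "j \<in> A" "f i = f j"
  then show "i = j"
    using triangular[of i j] triangular[of j i] diagonal[of i] diagonal[of j] by auto
qed

lemma independent_family: "independent (f ` A)"
  unfolding independent_explicit_module
proof (intro allI impI, rule ccontr)
  fix V u v
  assume vanishing: "finite V" "V \<subseteq> f ` A" "(\<Sum>w\<in>V. u w *s w) = 0"
    and nonzero: "v \<in> V" "u v \<noteq> 0"
  from vanishing(2) obtain F where reindex: "F \<subseteq> A" "inj_on f F" "V = f ` F"
    by (meson subset_image_inj)
  have "finite F"
    using vanishing(1) reindex by (simp add: finite_image_iff)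
  define X where "X = {j \<in> F. u (f j) \<noteq> 0}"
  have "finite X" "X \<noteq> {}"
    using \<open>finite F\<close> nonzero reindex(3) by (auto simp: X_def)
  then have "Max (rank ` X) \<in> rank ` X"
    by (intro Max_in) auto
  then obtain i where "i \<in> X" "rank i = Max (rank ` X)"
    by (metis imageE)
  moreover from this have "rank j \<le> rank i" if "j \<in> X" for j
    using \<open>finite X\<close> that by simp
  ultimately have top: "i \<in> X" "\<And>j. j \<in> X \<Longrightarrow> rank j \<le> rank i"
    by blast+
  have "0 = coord i (\<Sum>j\<in>F. u (f j) *s f j)"
    using vanishing(3) top(1) reindex by (auto simp: X_def sum.reindex coord_0)
  also have "\<dots> = u (f i) * coord i (f i)"
    using top reindex(1) \<open>finite F\<close> by (subst coord_combination_top_rank) (auto simp: X_def)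
  finally show False
    using top(1) reindex(1) diagonal by (auto simp: X_def)
qed

lemma ex_lower_rank_modulo_span:
  assumes finite_coord: "\<And>j. j \<in> A \<Longrightarrow> finite {i \<in> A. coord i (f j) \<noteq> 0}"
    and "finite {i \<in> A. coord i h \<noteq> 0}" "\<And>i. i \<in> A \<Longrightarrow> coord i h \<noteq> 0 \<Longrightarrow> rank i \<le> k"
  obtains t where "t \<in> span (f ` A)" "finite {i \<in> A. coord i (h - t) \<noteq> 0}"
    "\<And>i. i \<in> A \<Longrightarrow> coord i (h - t) \<noteq> 0 \<Longrightarrow> rank i < k"
proof
  define X where "X = {i \<in> A. coord i h \<noteq> 0 \<and> rank i = k}"
  let ?t = "\<Sum>j\<in>X. (coord j h / coord j (f j)) *s f j"
  have X_subset: "finite X" "X \<subseteq> A"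
    using assms(2) by (auto simp: X_def intro: finite_subset[rotated])
  show "?t \<in> span (f ` A)"
    using X_subset(2) by (intro span_sum span_scale span_base) auto
  show "finite {i \<in> A. coord i (h - ?t) \<noteq> 0}"
  proof (rule finite_subset)
    show "{i \<in> A. coord i (h - ?t) \<noteq> 0} \<subseteq>
        {i \<in> A. coord i h \<noteq> 0} \<union> (\<Union>j\<in>X. {i \<in> A. coord i (f j) \<noteq> 0})"
      by (auto simp: coord_diff coord_combination intro: sum.neutral)
    show "finite \<dots>"
      using assms(2) X_subset finite_coord by auto
  qed
  show "rank i < k" if higher: "i \<in> A" "coord i (h - ?t) \<noteq> 0" for i
  proof (rule ccontr)
    assume top: "\<not> rank i < k"
    then have "coord i ?t = (if i \<in> X then coord i h else 0)"
      using X_subset higher(1) diagonal[OF higher(1)]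
      by (subst coord_combination_top_rank) (auto simp: X_def)
    also have "\<dots> = coord i h"
      using assms(3)[OF higher(1)] higher(1) top by (auto simp: X_def)
    finally show False
      using higher by (simp add: coord_diff)
  qed
qed

lemma ex_span_coords_eq:
  assumes finite_coord: "\<And>j. j \<in> A \<Longrightarrow> finite {i \<in> A. coord i (f j) \<noteq> 0}"
    and finite_support: "finite {i \<in> A. coord i h \<noteq> 0}"
  obtains s where "s \<in> span (f ` A)" "\<And>i. i \<in> A \<Longrightarrow> coord i s = coord i h"
proof -
  obtain k where "\<And>i. i \<in> A \<Longrightarrow> coord i h \<noteq> 0 \<Longrightarrow> rank i < k"
    using finite_nat_set_iff_bounded[of "rank ` {i \<in> A. coord i h \<noteq> 0}"] finite_support by auto
  with finite_support have "\<exists>s\<in>span (f ` A). \<forall>i\<in>A. coord i s = coord i h"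
  proof (induction k arbitrary: h)
    case 0
    then show ?case
      by (intro bexI[of _ 0]) (auto simp: coord_0 span_zero)
  next
    case (Suc k)
    then have "rank i \<le> k" if "i \<in> A" "coord i h \<noteq> 0" for i
      using that by (simp add: less_Suc_eq_le)
    with Suc.prems(1) obtain t where lower: "t \<in> span (f ` A)"
        "finite {i \<in> A. coord i (h - t) \<noteq> 0}"
        "\<And>i. i \<in> A \<Longrightarrow> coord i (h - t) \<noteq> 0 \<Longrightarrow> rank i < k"
      using ex_lower_rank_modulo_span[OF finite_coord, of h k] by blast
    then obtain s where "s \<in> span (f ` A)" "\<forall>i\<in>A. coord i s = coord i (h - t)"
      using Suc.IH by blast
    with lower(1) show ?case
      by (intro bexI[of _ "s + t"]) (auto simp: coord_add coord_diff span_add)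
  qed
  with that show ?thesis
    by blast
qed

end

lemma (in vector_space) ex_dual_functional:
  assumes "inj_on f A" "independent (f ` A)" "i \<in> A"
  shows "\<exists>\<phi>. Vector_Spaces.linear scale (*) \<phi> \<and> (\<forall>j\<in>A. \<phi> (f j) = (if j = i then 1 else 0))"
proof -
  interpret pair: vector_space_pair scale "(*)"
    by unfold_locales (auto simp: algebra_simps)
  obtain \<phi> where "Vector_Spaces.linear scale (*) \<phi>" "\<forall>x\<in>f ` A. \<phi> x = (if x = f i then 1 else 0)"
    using pair.linear_independent_extend[OF assms(2), of "\<lambda>x. if x = f i then 1 else 0"] by blast
  with assms(1,3) show ?thesis
    by (intro exI[of _ \<phi>]) (auto simp: inj_on_eq_iff)
qed


section \<open>Columns and words\<close>

lemma wt_superset: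
  assumes "finite A" "Poly_Mapping.keys v \<subseteq> A"
  shows "wt v = (\<Sum>c\<in>A. Poly_Mapping.lookup v c)"
  unfolding wt_def using assms
  by (intro sum.mono_neutral_left) (auto simp: in_keys_iff)

lemma wt_zero [simp]: "wt 0 = 0"
  by (simp add: wt_def)

lemma wt_add [simp]: "wt (v + w) = wt v + wt w"
proof -
  let ?A = "Poly_Mapping.keys v \<union> Poly_Mapping.keys w"
  have "wt (v + w) = (\<Sum>c\<in>?A. Poly_Mapping.lookup (v + w) c)"
    using Poly_Mapping.keys_add[of v w] by (intro wt_superset) auto
  also have "\<dots> = wt v + wt w"
    by (simp add: lookup_add sum.distrib wt_superset[of ?A v] wt_superset[of ?A w])
  finally show ?thesis .
qed

lemma wt_sum_list: "wt (sum_list I) = (\<Sum>i\<leftarrow>I. wt i)"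
  by (induction I) auto

lemma wt_eq_0_iff [simp]: "wt v = 0 \<longleftrightarrow> v = 0"
proof
  assume "wt v = 0"
  then show "v = 0"
    by (intro poly_mapping_eqI) (auto simp: wt_def in_keys_iff)
qed simp

lemma wt_pos_iff [simp]: "wt v > 0 \<longleftrightarrow> v \<noteq> 0"
  by (simp add: zero_less_iff_neq_zero)

lemma wt_single [simp]: "wt (Poly_Mapping.single c n) = n"
  by (cases "n = 0") (auto simp: wt_def)

lemma cvec_sum_list_eq_0_iff: "sum_list (I :: vcomp) = 0 \<longleftrightarrow> (\<forall>i\<in>set I. i = 0)"
  unfolding wt_eq_0_iff[symmetric] wt_sum_list by simp

lemma keys_cvec_sum_list:
  "Poly_Mapping.keys (sum_list I :: cvec) = (\<Union>i\<in>set I. Poly_Mapping.keys i)"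
proof (induction I)
  case (Cons i I)
  have "Poly_Mapping.keys (i + sum_list I) = Poly_Mapping.keys i \<union> Poly_Mapping.keys (sum_list I)"
    by (auto simp: in_keys_iff lookup_add)
  with Cons show ?case
    by simp
qed simp

lemma length_le_wt_sum_list: "0 \<notin> set I \<Longrightarrow> length I \<le> wt (sum_list I)"
proof (induction I)
  case (Cons i I)
  then have "wt i > 0" "length I \<le> wt (sum_list I)"
    by auto
  then show ?case
    by (simp del: wt_pos_iff)
qed simp

definition word_vec :: "color_word \<Rightarrow> cvec" where
  "word_vec w = sum_list (E w)"

definition column_word :: "cvec \<Rightarrow> color_word" where
  "column_word v = concat (map (\<lambda>c. replicate (Poly_Mapping.lookup v c) c)
                             (sorted_list_of_set (Poly_Mapping.keys v)))"

lemma E_Nil [simp]: "E [] = []"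
  and E_Cons: "E (c # w) = Poly_Mapping.single c 1 # E w"
  and E_append: "E (v @ w) = E v @ E w"
  by (simp_all add: E_def)

lemma zero_notin_E: "0 \<notin> set (E w)"
proof -
  have "Poly_Mapping.single c 1 \<noteq> (0 :: cvec)" for c
    by (metis wt_single wt_zero zero_neq_one)
  then show ?thesis
    by (auto simp: E_def)
qed

lemma word_vec_Nil [simp]: "word_vec [] = 0"
  by (simp add: word_vec_def)

lemma word_vec_Cons: "word_vec (c # w) = Poly_Mapping.single c 1 + word_vec w"
  by (simp add: word_vec_def E_Cons)

lemma lookup_word_vec: "Poly_Mapping.lookup (word_vec w) c = count (mset w) c"
  by (induction w) (auto simp: word_vec_Cons lookup_add lookup_single when_def)

lemma wt_word_vec [simp]: "wt (word_vec w) = length w"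
  by (induction w) (auto simp: word_vec_Cons)

lemma keys_word_vec: "Poly_Mapping.keys (word_vec w) = set w"
  by (auto simp: in_keys_iff lookup_word_vec)

lemma count_mset_column_word: "count (mset (column_word v)) c = Poly_Mapping.lookup v c"
proof -
  have "count (mset (concat (map (\<lambda>c. replicate (f c) c) cs))) c = (if c \<in> set cs then f c else 0)"
    if "distinct cs" for cs and f :: "nat \<Rightarrow> nat"
    using that by (induction cs) auto
  from this[of "sorted_list_of_set (Poly_Mapping.keys v)"] show ?thesis
    by (simp add: column_word_def in_keys_iff)
qed

lemma sorted_column_word: "sorted (column_word v)"
proof -
  have "sorted (concat (map (\<lambda>c. replicate (f c) c) cs))"
    if "sorted cs" for cs and f :: "nat \<Rightarrow> nat"
    using that by (induction cs) (auto simp: sorted_append)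
  then show ?thesis
    by (simp add: column_word_def)
qed

lemma word_vec_column_word [simp]: "word_vec (column_word v) = v"
  by (rule poly_mapping_eqI) (simp add: lookup_word_vec count_mset_column_word)

lemma column_word_word_vec: "sorted w \<Longrightarrow> column_word (word_vec w) = w"
  by (metis lookup_word_vec count_mset_column_word multiset_eqI properties_for_sort sorted_column_word)

lemma length_column_word [simp]: "length (column_word v) = wt v"
  by (metis word_vec_column_word wt_word_vec)

lemma set_column_word: "set (column_word v) = Poly_Mapping.keys v"
  by (metis word_vec_column_word keys_word_vec)

lemma cw_eq_concat: "cw I = concat (map column_word I)"
  unfolding cw_def column_word_def ..

lemma cw_Nil [simp]: "cw [] = []" and cw_Cons: "cw (i # I) = column_word i @ cw I"
  by (simp_all add: cw_eq_concat)

lemma cw_map_word_vec: "\<forall>w\<in>set ws. sorted w \<Longrightarrow> cw (map word_vec ws) = concat ws"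
  by (simp add: cw_eq_concat column_word_word_vec map_idI)

lemma length_cw: "length (cw I) = wt (sum_list I)"
  by (induction I) (auto simp: cw_Cons)

lemma set_cw: "set (cw I) = Poly_Mapping.keys (sum_list I)"
  by (simp add: cw_eq_concat set_column_word keys_cvec_sum_list)

lemma eq_if_cw_eq_wt_eq:
  assumes "cw I = cw J" "map wt I = map wt J"
  shows "I = J"
  using assms
proof (induction I arbitrary: J)
  case (Cons i I)
  then obtain j J' where J_eq: "J = j # J'"
    by (cases J) auto
  with Cons.prems have "column_word i = column_word j" "cw I = cw J'"
    by (auto simp: cw_Cons)
  then have "i = j" "I = J'"
    using Cons J_eq by (metis word_vec_column_word) (use Cons J_eq \<open>cw I = cw J'\<close> in simp)
  with J_eq show ?case
    by simp
qed simp

lemma vcomps_iff: "I \<in> vcomps l \<longleftrightarrow> 0 \<notin> set I \<and> Poly_Mapping.keys (sum_list I) \<subseteq> {..<l}"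
  by (auto simp: vcomps_def keys_cvec_sum_list)

lemma vcomps_append_iff: "I @ J \<in> vcomps l \<longleftrightarrow> I \<in> vcomps l \<and> J \<in> vcomps l"
  by (auto simp: vcomps_def)


section \<open>Coarsening\<close>

lemma coarsens_Nil_left [simp]: "[] \<unlhd> I \<longleftrightarrow> I = []"
  by (auto simp: coarsens_def)

lemma coarsens_Cons_iff:
  "j # J \<unlhd> I \<longleftrightarrow> (\<exists>B I'. I = B @ I' \<and> B \<noteq> [] \<and> j = sum_list B \<and> J \<unlhd> I')"
proof
  assume "j # J \<unlhd> I"
  then obtain B Bs where "I = B @ concat Bs" "B \<noteq> []" "j = sum_list B"
    and "J = map sum_list Bs" "[] \<notin> set Bs"
    by (auto simp: coarsens_def)
  moreover from this have "J \<unlhd> concat Bs"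
    by (auto simp: coarsens_def)
  ultimately show "\<exists>B I'. I = B @ I' \<and> B \<noteq> [] \<and> j = sum_list B \<and> J \<unlhd> I'"
    by blast
next
  assume "\<exists>B I'. I = B @ I' \<and> B \<noteq> [] \<and> j = sum_list B \<and> J \<unlhd> I'"
  then obtain B I' where block: "I = B @ I'" "B \<noteq> []" "j = sum_list B" and "J \<unlhd> I'"
    by blast
  then obtain Bs where "concat Bs = I'" "[] \<notin> set Bs" "J = map sum_list Bs"
    by (auto simp: coarsens_def)
  with block show "j # J \<unlhd> I"
    unfolding coarsens_def by (intro exI[of _ "B # Bs"]) simp
qed

lemma coarsens_singleton_iff: "[j] \<unlhd> I \<longleftrightarrow> I \<noteq> [] \<and> j = sum_list I"
  by (auto simp: coarsens_Cons_iff)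

lemma coarsens_Nil_right [simp]: "J \<unlhd> [] \<longleftrightarrow> J = []"
  by (cases J) (auto simp: coarsens_Cons_iff)

lemma coarsens_append_iff:
  "J @ K \<unlhd> I \<longleftrightarrow> (\<exists>I1 I2. I = I1 @ I2 \<and> J \<unlhd> I1 \<and> K \<unlhd> I2)"
proof (induction J arbitrary: I)
  case (Cons j J)
  show ?case
    by (auto simp: coarsens_Cons_iff Cons.IH) (metis append.assoc)+
qed simp

lemma coarsens_append: "J \<unlhd> I1 \<Longrightarrow> K \<unlhd> I2 \<Longrightarrow> J @ K \<unlhd> I1 @ I2"
  using coarsens_append_iff by blast

lemma coarsens_refl [simp]: "I \<unlhd> I"
  by (induction I) (auto simp: coarsens_Cons_iff intro: exI[of _ "[_]"])

lemma coarsens_sum_list: "J \<unlhd> I \<Longrightarrow> sum_list J = sum_list I"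
  by (induction J arbitrary: I) (auto simp: coarsens_Cons_iff)

lemma coarsens_trans: "J \<unlhd> K \<Longrightarrow> K \<unlhd> I \<Longrightarrow> J \<unlhd> I"
proof (induction J arbitrary: K I)
  case (Cons j J)
  from Cons.prems(1) obtain B K' where K_split: "K = B @ K'" "B \<noteq> []" "j = sum_list B" "J \<unlhd> K'"
    by (auto simp: coarsens_Cons_iff)
  from Cons.prems(2) obtain I1 I2 where I_split: "I = I1 @ I2" "B \<unlhd> I1" "K' \<unlhd> I2"
    unfolding K_split(1) coarsens_append_iff by blast
  have "I1 \<noteq> []" "j = sum_list I1" "J \<unlhd> I2"
    using K_split I_split coarsens_sum_list[OF I_split(2)] Cons.IH by auto
  with I_split(1) show ?case
    by (auto simp: coarsens_Cons_iff)
qed auto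

lemma coarsens_length_le: "J \<unlhd> I \<Longrightarrow> length J \<le> length I"
proof (induction J arbitrary: I)
  case (Cons j J)
  then obtain B I' where "I = B @ I'" "B \<noteq> []" "J \<unlhd> I'"
    by (auto simp: coarsens_Cons_iff)
  with Cons.IH[of I'] show ?case
    by (cases B) auto
qed simp

lemma coarsens_eq_if_length_le: "J \<unlhd> I \<Longrightarrow> length I \<le> length J \<Longrightarrow> J = I"
proof (induction J arbitrary: I)
  case (Cons j J)
  then obtain B I' where split: "I = B @ I'" "B \<noteq> []" "j = sum_list B" "J \<unlhd> I'"
    by (auto simp: coarsens_Cons_iff)
  have "length B \<le> 1"
    using Cons.prems(2) coarsens_length_le[OF split(4)] unfolding split(1) by simp
  then obtain b where "B = [b]"
    using split(2) by (cases B) auto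
  with Cons split show ?case
    by auto
qed simp

lemma coarsens_singleton_right [simp]: "J \<unlhd> [i] \<longleftrightarrow> J = [i]"
  using coarsens_eq_if_length_le[of J "[i]"] by (cases J) auto

lemma coarsens_antisym: "J \<unlhd> I \<Longrightarrow> I \<unlhd> J \<Longrightarrow> J = I"
  using coarsens_eq_if_length_le coarsens_length_le by blast

lemma coarsens_nonzero:
  assumes "J \<unlhd> I" "0 \<notin> set I"
  shows "0 \<notin> set J"
  using assms
proof (induction J arbitrary: I)
  case (Cons j J)
  then obtain B I' where "I = B @ I'" "B \<noteq> []" "j = sum_list B" "J \<unlhd> I'"
    by (auto simp: coarsens_Cons_iff)
  with Cons show ?case
    using cvec_sum_list_eq_0_iff[of B] by (cases B) auto
qed simp

lemma coarsens_vcomps: "J \<unlhd> I \<Longrightarrow> I \<in> vcomps l \<Longrightarrow> J \<in> vcomps l"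
  using coarsens_nonzero coarsens_sum_list by (simp add: vcomps_iff)

lemma Collect_coarsens_Cons:
  assumes "I \<noteq> []"
  shows "{J. J \<unlhd> i # I} = (#) i ` {J. J \<unlhd> I} \<union> (\<lambda>J. (i + hd J) # tl J) ` {J. J \<unlhd> I}"
proof (intro equalityI subsetI)
  fix J assume "J \<in> {J. J \<unlhd> i # I}"
  then obtain j J' B I' where first_block: "J = j # J'" "i # I = B @ I'" "B \<noteq> []"
      "j = sum_list B" "J' \<unlhd> I'"
    by (cases J) (auto simp: coarsens_Cons_iff)
  then obtain B' where tail: "B = i # B'" "I = B' @ I'"
    by (cases B) auto
  show "J \<in> (#) i ` {J. J \<unlhd> I} \<union> (\<lambda>J. (i + hd J) # tl J) ` {J. J \<unlhd> I}"
  proof (cases "B' = []")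
    case False
    with first_block tail have "sum_list B' # J' \<unlhd> I"
      by (auto simp: coarsens_Cons_iff)
    then show ?thesis
      using first_block tail by (intro UnI2 image_eqI[of _ _ "sum_list B' # J'"]) auto
  qed (use first_block tail in auto)
next
  fix J assume "J \<in> (#) i ` {J. J \<unlhd> I} \<union> (\<lambda>J. (i + hd J) # tl J) ` {J. J \<unlhd> I}"
  then consider J' where "J' \<unlhd> I" "J = i # J'"
    | j J' where "j # J' \<unlhd> I" "J = (i + j) # J'"
    using assms by (auto simp: neq_Nil_conv) (metis coarsens_Nil_left assms list.collapse)
  then show "J \<in> {J. J \<unlhd> i # I}"
  proof cases
    case 1
    then show ?thesis
      using coarsens_append[of "[i]" "[i]"] by simp
  next
    case 2
    then obtain B I' where "I = B @ I'" "j = sum_list B" "J' \<unlhd> I'"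
      by (auto simp: coarsens_Cons_iff)
    then have "i # I = (i # B) @ I'" "i + j = sum_list (i # B)" "J' \<unlhd> I'"
      by simp_all
    then show ?thesis
      unfolding 2(2) mem_Collect_eq coarsens_Cons_iff by blast
  qed
qed

lemma finite_coarsens [simp]: "finite {J. J \<unlhd> I}"
proof (induction I)
  case (Cons i I)
  then show ?case
    by (cases "I = []") (auto simp: Collect_coarsens_Cons)
qed simp

lemma sum_power_length_coarsens:
  fixes x :: "'a :: comm_ring_1"
  assumes "0 \<notin> set I" "I \<noteq> []"
  shows "(\<Sum>J | J \<unlhd> I. x ^ length J) = x * (1 + x) ^ (length I - 1)"
  using assms
proof (induction I)
  case (Cons i I)
  show ?case
  proof (cases "I = []")
    case True
    then show ?thesis
      by simp
  next
    case False
    let ?C = "{J. J \<unlhd> I}" and ?merge = "\<lambda>J. (i + hd J) # tl J"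
    have nonempty: "J \<noteq> []" if "J \<unlhd> I" for J
      using that False by auto
    have "hd J \<noteq> 0" if "J \<unlhd> I" for J
      using coarsens_nonzero[OF that] Cons.prems nonempty[OF that] hd_in_set by fastforce
    then have "(#) i ` ?C \<inter> ?merge ` ?C = {}"
      by auto
    moreover have "inj_on ?merge ?C"
      using nonempty
      by (intro inj_onI) (metis add_left_cancel list.collapse list.inject mem_Collect_eq)
    ultimately have "(\<Sum>J | J \<unlhd> i # I. x ^ length J) =
        (\<Sum>J\<in>?C. x ^ length (i # J)) + (\<Sum>J\<in>?C. x ^ length (?merge J))"
      by (simp add: Collect_coarsens_Cons[OF False] sum.union_disjoint sum.reindex)
    also have "\<dots> = x * (\<Sum>J\<in>?C. x ^ length J) + (\<Sum>J\<in>?C. x ^ length J)"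
      using nonempty by (simp add: sum_distrib_left)
    also have "\<dots> = (1 + x) * (x * (1 + x) ^ (length I - 1))"
      using Cons False by (simp add: algebra_simps)
    also have "\<dots> = x * (1 + x) ^ (length (i # I) - 1)"
      using False by (cases I) (simp_all add: algebra_simps)
    finally show ?thesis .
  qed
qed simp

lemma coarsens_E_cw: "0 \<notin> set I \<Longrightarrow> I \<unlhd> E (cw I)"
proof (induction I)
  case (Cons i I)
  have "E (column_word i) \<noteq> []"
    using Cons.prems by (auto simp: E_def simp flip: length_0_conv)
  moreover have "sum_list (E (column_word i)) = i"
    by (simp flip: word_vec_def)
  ultimately have "[i] \<unlhd> E (column_word i)"
    by (simp add: coarsens_singleton_iff)
  from coarsens_append[OF this, of I "E (cw I)"] Cons show ?case
    by (simp add: cw_Cons E_append)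
qed simp

definition compositions :: "cvec \<Rightarrow> vcomp set" where
  "compositions n = {J. 0 \<notin> set J \<and> sum_list J = n}"

lemma finite_compositions: "finite (compositions n)"
proof (rule finite_subset)
  let ?U = "{u. set u \<subseteq> Poly_Mapping.keys n \<and> length u = wt n}"
  show "compositions n \<subseteq> (\<Union>u\<in>?U. {J. J \<unlhd> E u})"
  proof
    fix J assume "J \<in> compositions n"
    then have "J \<unlhd> E (cw J)" "cw J \<in> ?U"
      by (auto simp: compositions_def coarsens_E_cw length_cw set_cw)
    then show "J \<in> (\<Union>u\<in>?U. {J. J \<unlhd> E u})"
      by blast
  qed
  show "finite (\<Union>u\<in>?U. {J. J \<unlhd> E u})"
    by (intro finite_UN_I finite_lists_length_eq finite_keys finite_coarsens)
qed


section \<open>Descents\<close>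

definition column_ends :: "(cvec \<Rightarrow> bool) \<Rightarrow> vcomp \<Rightarrow> nat set" where
  "column_ends P I = {partial_wt I r |r. 1 \<le> r \<and> r < length I \<and> P (I ! (r - 1))}"

lemma D_eq_column_ends: "D = column_ends (\<lambda>_. True)"
  by (simp add: fun_eq_iff D_def column_ends_def)

lemma Pk_eq_column_ends: "Pk = column_ends (\<lambda>i. wt i \<ge> 2)"
  by (simp add: fun_eq_iff Pk_def column_ends_def)

lemma column_ends_Nil: "column_ends P [] = {}"
  by (simp add: column_ends_def)

lemma column_ends_Cons:
  "column_ends P (i # I) = (if I \<noteq> [] \<and> P i then {wt i} else {}) \<union> (+) (wt i) ` column_ends P I"
proof -
  let ?R = "\<lambda>I. {r. 1 \<le> r \<and> r < length I \<and> P (I ! (r - 1))}"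
  have column_ends: "column_ends P I = partial_wt I ` ?R I" for I
    by (auto simp: column_ends_def)
  have "r \<in> ?R (i # I) \<longleftrightarrow> r \<in> (if I \<noteq> [] \<and> P i then {1} else {}) \<union> Suc ` ?R I" for r
    by (cases r; cases "r - 1") auto
  then have "?R (i # I) = (if I \<noteq> [] \<and> P i then {1} else {}) \<union> Suc ` ?R I"
    by blast
  moreover have "partial_wt (i # I) 1 = wt i"
    "partial_wt (i # I) (Suc r) = wt i + partial_wt I r" for r
    by (simp_all add: partial_wt_def)
  ultimately show ?thesis
    by (simp only: column_ends image_Un image_image if_distrib[of "(`) _"] image_insert image_empty)
qed

lemma D_Nil [simp]: "D [] = {}" and Pk_Nil [simp]: "Pk [] = {}"
  by (simp_all add: D_eq_column_ends Pk_eq_column_ends column_ends_Nil)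

lemma D_Cons: "D (i # I) = (if I = [] then {} else insert (wt i) ((+) (wt i) ` D I))"
  by (simp add: D_eq_column_ends column_ends_Cons column_ends_Nil)

lemma Pk_Cons:
  "Pk (i # I) = (if I \<noteq> [] \<and> wt i \<ge> 2 then {wt i} else {}) \<union> (+) (wt i) ` Pk I"
  by (simp add: Pk_eq_column_ends column_ends_Cons)

lemma D_append:
  "D (I @ J) = D I \<union> (if I \<noteq> [] \<and> J \<noteq> [] then {wt (sum_list I)} else {}) \<union>
    (+) (wt (sum_list I)) ` D J"
  by (induction I) (auto simp: D_Cons image_iff add.assoc)

lemma D_subset:
  assumes "0 \<notin> set I"
  shows "D I \<subseteq> {0<..<wt (sum_list I)}"
  using assms
proof (induction I)
  case (Cons i I)
  have "wt i > 0"
    using Cons.prems by auto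
  moreover have "wt (sum_list I) > 0" if "I \<noteq> []"
    using Cons.prems that by (auto simp: cvec_sum_list_eq_0_iff neq_Nil_conv)
  ultimately show ?case
    using Cons by (auto simp: D_Cons)
qed simp

lemma add_wt_in_D_append_iff:
  assumes "0 \<notin> set I" "d > 0"
  shows "wt (sum_list I) + d \<in> D (I @ J) \<longleftrightarrow> d \<in> D J"
  using D_subset[OF assms(1)] assms(2) by (auto simp: D_append)

lemma D_split:
  assumes "d \<in> D I"
  obtains I1 I2 where "I = I1 @ I2" "I1 \<noteq> []" "I2 \<noteq> []" "d = wt (sum_list I1)"
  using assms
proof (induction I arbitrary: d thesis)
  case (Cons i I)
  show ?case
  proof (cases "d = wt i")
    case True
    with Cons.prems show ?thesis
      by (intro Cons.prems(1)[of "[i]" I]) (auto simp: D_Cons)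
  next
    case False
    with Cons.prems(2) obtain e where "e \<in> D I" "d = wt i + e"
      by (auto simp: D_Cons split: if_splits)
    moreover from this obtain I1 I2 where "I = I1 @ I2" "I1 \<noteq> []" "I2 \<noteq> []" "e = wt (sum_list I1)"
      using Cons.IH by blast
    ultimately show ?thesis
      by (intro Cons.prems(1)[of "i # I1" I2]) auto
  qed
qed simp

lemma coarsens_D_subset: "J \<unlhd> I \<Longrightarrow> D J \<subseteq> D I"
proof (induction J arbitrary: I)
  case (Cons j J)
  then obtain B I' where split: "I = B @ I'" "B \<noteq> []" "j = sum_list B" "J \<unlhd> I'"
    by (auto simp: coarsens_Cons_iff)
  with Cons.IH[OF split(4)] show ?case
    by (auto simp: D_Cons D_append)
qed simp

lemma append_eq_append_if_wt_eq:
  assumes "A @ B = A' @ B'" "0 \<notin> set (A @ B)" "wt (sum_list A) = wt (sum_list A')"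
  shows "A = A'"
proof -
  from assms(1) obtain C where C_cases: "A = A' @ C \<or> A' = A @ C"
    by (auto simp: append_eq_append_conv2)
  moreover have "0 \<notin> set (A' @ B')"
    using assms(2) unfolding assms(1) .
  then have "0 \<notin> set C"
    using C_cases assms(2) by auto
  moreover have "wt (sum_list C) = 0"
    using C_cases assms(3) by auto
  ultimately show ?thesis
    using length_le_wt_sum_list[of C] by auto
qed

lemma coarsens_iff_D_subset:
  assumes "0 \<notin> set K" "J \<unlhd> K" "I \<unlhd> K"
  shows "J \<unlhd> I \<longleftrightarrow> D J \<subseteq> D I"
proof
  show "D J \<subseteq> D I \<Longrightarrow> J \<unlhd> I"
    using assms
  proof (induction J arbitrary: I K)
    case (Cons j J)
    from Cons.prems obtain B K' where K_split: "K = B @ K'" "B \<noteq> []" "j = sum_list B" "J \<unlhd> K'"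
      by (auto simp: coarsens_Cons_iff)
    show ?case
    proof (cases "J = []")
      case True
      with Cons.prems K_split show ?thesis
        using coarsens_sum_list[of I K] by (auto simp: coarsens_singleton_iff)
    next
      case False
      then have "wt j \<in> D I"
        using Cons.prems(1) by (auto simp: D_Cons)
      then obtain I1 I2 where I_split: "I = I1 @ I2" "I1 \<noteq> []" "wt j = wt (sum_list I1)"
        using D_split by metis
      from Cons.prems(4) obtain K1 K2 where matching: "K = K1 @ K2" "I1 \<unlhd> K1" "I2 \<unlhd> K2"
        unfolding I_split(1) coarsens_append_iff by blast
      have "wt (sum_list K1) = wt (sum_list B)"
        using coarsens_sum_list[OF matching(2)] I_split(3) K_split(3) by simp
      then have "K1 = B"
        using append_eq_append_if_wt_eq[of K1 K2 B K'] Cons.prems(2) K_split(1) matching(1)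
        by simp
      with K_split matching have same_split: "K2 = K'" "j = sum_list I1"
        using coarsens_sum_list by auto
      have nonzero: "0 \<notin> set I1" "0 \<notin> set J"
        using Cons.prems coarsens_nonzero I_split(1) by fastforce+
      then have "D J \<subseteq> D I2"
        using Cons.prems(1) False I_split D_subset[of J] add_wt_in_D_append_iff[of I1 _ I2]
        by (force simp: D_Cons)
      then have "J \<unlhd> I2"
        using Cons.IH[of I2 K'] Cons.prems(2) K_split matching(3) same_split(1) by auto
      with I_split same_split(2) show ?thesis
        by (auto simp: coarsens_Cons_iff)
    qed
  qed simp
qed (rule coarsens_D_subset)


section \<open>Odd compositions and their refinements\<close>

lemma odd_blocks_Nil [simp]: "odd_blocks I [] \<longleftrightarrow> I = []"
  by (auto simp: odd_blocks_def)

lemma odd_blocks_Cons_iff: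
  "odd_blocks I (B # Bs) \<longleftrightarrow> (\<exists>I'. I = B @ I' \<and> odd_blocks I' Bs) \<and>
    B \<noteq> [] \<and> odd (wt (last B)) \<and> (\<forall>i\<in>set (butlast B). even (wt i))"
  by (auto simp: odd_blocks_def)

lemma odd_blocks_unique: "odd_blocks I Bs \<Longrightarrow> odd_blocks I Cs \<Longrightarrow> Bs = Cs"
proof (induction Bs arbitrary: I Cs)
  case Nil
  then show ?case
    by (cases Cs) (auto simp: odd_blocks_Cons_iff)
next
  case (Cons B Bs)
  then obtain C Cs' where Cs_eq: "Cs = C # Cs'"
    by (cases Cs) (auto simp: odd_blocks_Cons_iff)
  from Cons.prems obtain I1 I2
    where split: "I = B @ I1" "I = C @ I2" "odd_blocks I1 Bs" "odd_blocks I2 Cs'"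
    and blocks: "B \<noteq> []" "odd (wt (last B))" "\<forall>i\<in>set (butlast B). even (wt i)"
      "C \<noteq> []" "odd (wt (last C))" "\<forall>i\<in>set (butlast C). even (wt i)"
    unfolding Cs_eq odd_blocks_Cons_iff by blast
  from split(1,2) obtain X where "B = C @ X \<or> B @ X = C"
    by (auto simp: append_eq_append_conv2)
  with blocks have "B = C"
    by (cases "X = []") (auto simp: butlast_append)
  with Cons.IH[OF split(3)] split Cs_eq show ?case
    by simp
qed

lemma odd_comp_eqI: "odd_blocks I Bs \<Longrightarrow> odd_comp I = map sum_list Bs"
  unfolding odd_comp_def using odd_blocks_unique by (metis the_equality)

text \<open>The graph of \<open>I \<mapsto> odd(I)\<close> restricted to the compositions of the form \<open>I\<^bsub>S,u\<^esub>\<close>.\<close>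

inductive odd_merge :: "vcomp \<Rightarrow> vcomp \<Rightarrow> bool" where
  Nil: "odd_merge [] []"
| one: "wt i = 1 \<Longrightarrow> odd_merge I K \<Longrightarrow> odd_merge (i # I) (i # K)"
| two: "wt i = 2 \<Longrightarrow> odd_merge I (k # K) \<Longrightarrow> odd_merge (i # I) ((i + k) # K)"

lemma odd_merge_Nil_iff: "odd_merge I K \<Longrightarrow> I = [] \<longleftrightarrow> K = []"
  by (cases rule: odd_merge.cases) auto

lemma odd_merge_odd_comp: "odd_merge I K \<Longrightarrow> odd_comp I = K"
proof -
  assume "odd_merge I K"
  then have "\<exists>Bs. odd_blocks I Bs \<and> K = map sum_list Bs"
  proof induction
    case (one i I K)
    then obtain Bs where "odd_blocks I Bs" "K = map sum_list Bs"
      by blast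
    with one.hyps(1) show ?case
      by (intro exI[of _ "[i] # Bs"]) (auto simp: odd_blocks_Cons_iff)
  next
    case (two i I k K)
    then obtain B Bs where "odd_blocks I (B # Bs)" "k = sum_list B" "K = map sum_list Bs"
      by (auto simp: Cons_eq_map_conv)
    with two.hyps(1) show ?case
      by (intro exI[of _ "(i # B) # Bs"]) (auto simp: odd_blocks_Cons_iff)
  qed simp
  then show ?thesis
    using odd_comp_eqI by blast
qed

lemma ex_odd_merge_iff:
  "(\<exists>K. odd_merge I K) \<longleftrightarrow>
    (\<forall>i\<in>set I. wt i = 1 \<or> wt i = 2) \<and> (I \<noteq> [] \<longrightarrow> odd (wt (last I)))"
proof
  assume "\<exists>K. odd_merge I K"
  then obtain K where "odd_merge I K" ..
  then show "(\<forall>i\<in>set I. wt i = 1 \<or> wt i = 2) \<and> (I \<noteq> [] \<longrightarrow> odd (wt (last I)))"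
    by induction (auto simp: odd_merge_Nil_iff)
next
  assume "(\<forall>i\<in>set I. wt i = 1 \<or> wt i = 2) \<and> (I \<noteq> [] \<longrightarrow> odd (wt (last I)))"
  then show "\<exists>K. odd_merge I K"
  proof (induction I)
    case (Cons i I)
    then obtain K where merge: "odd_merge I K"
      by (auto split: if_splits)
    show ?case
    proof (cases "wt i = 1")
      case False
      with Cons.prems have "wt i = 2" "I \<noteq> []"
        by auto
      with merge show ?thesis
        by (cases K) (auto dest: odd_merge_Nil_iff intro: odd_merge.two)
    qed (use merge in \<open>blast intro: odd_merge.one\<close>)
  qed (auto intro: odd_merge.Nil)
qed

lemma is_peak_comp_iff:
  "is_peak_comp S u I \<longleftrightarrow> odd_merge I (odd_comp I) \<and> cw I = u \<and> Pk I = S"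
  using ex_odd_merge_iff[of I] odd_merge_odd_comp unfolding is_peak_comp_def by metis

definition tilde_block :: "vcomp \<Rightarrow> bool" where
  "tilde_block B \<longleftrightarrow> B \<noteq> [] \<and> (\<forall>b\<in>set (butlast B). wt b = 2) \<and> wt (last B) = 1"

lemma tilde_block_Cons_iff:
  "tilde_block (b # B) \<longleftrightarrow> (if B = [] then wt b = 1 else wt b = 2 \<and> tilde_block B)"
  by (auto simp: tilde_block_def)

lemma odd_merge_append_tilde_block:
  assumes "odd_merge I K" "tilde_block B"
  shows "odd_merge (B @ I) (sum_list B # K)"
  using assms(2)
proof (induction B)
  case (Cons b B)
  then show ?case
    using assms(1) by (cases "B = []") (auto simp: tilde_block_Cons_iff intro: odd_merge.intros)
qed (simp add: tilde_block_def)

lemma odd_merge_iff_tilde_blocks: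
  "odd_merge I K \<longleftrightarrow> (\<exists>Bs. I = concat Bs \<and> K = map sum_list Bs \<and> (\<forall>B\<in>set Bs. tilde_block B))"
proof
  assume "odd_merge I K"
  then show "\<exists>Bs. I = concat Bs \<and> K = map sum_list Bs \<and> (\<forall>B\<in>set Bs. tilde_block B)"
  proof induction
    case (one i I K)
    then obtain Bs where "I = concat Bs" "K = map sum_list Bs" "\<forall>B\<in>set Bs. tilde_block B"
      by blast
    with one.hyps(1) show ?case
      by (intro exI[of _ "[i] # Bs"]) (auto simp: tilde_block_Cons_iff)
  next
    case (two i I k K)
    then obtain B Bs where "I = B @ concat Bs" "k = sum_list B" "K = map sum_list Bs"
        "tilde_block B" "\<forall>B\<in>set Bs. tilde_block B"
      by (auto simp: Cons_eq_map_conv)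
    with two.hyps(1) show ?case
      by (intro exI[of _ "(i # B) # Bs"]) (auto simp: tilde_block_Cons_iff tilde_block_def[of "[]"])
  qed simp
next
  have "odd_merge (concat Bs) (map sum_list Bs)" if "\<forall>B\<in>set Bs. tilde_block B" for Bs
    using that by (induction Bs) (auto intro: odd_merge.Nil odd_merge_append_tilde_block)
  then show "\<exists>Bs. I = concat Bs \<and> K = map sum_list Bs \<and> (\<forall>B\<in>set Bs. tilde_block B) \<Longrightarrow> odd_merge I K"
    by blast
qed

lemma is_tilde_iff: "is_tilde K I \<longleftrightarrow> odd_merge I K \<and> cw I = cw K"
proof -
  have "list_all2 (\<lambda>i B. sum_list B = i \<and> B \<noteq> [] \<and> (\<forall>b\<in>set (butlast B). wt b = 2) \<and>
      wt (last B) = 1) K Bs \<longleftrightarrow> K = map sum_list Bs \<and> (\<forall>B\<in>set Bs. tilde_block B)" for Bs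
    by (induction Bs arbitrary: K) (auto simp: list_all2_Cons2 tilde_block_def)
  then show ?thesis
    unfolding is_tilde_def odd_merge_iff_tilde_blocks by blast
qed

lemma odd_merge_sum_list: "odd_merge I K \<Longrightarrow> sum_list K = sum_list I"
  by (induction rule: odd_merge.induct) (auto simp: add.assoc)

lemma odd_merge_nonzero: "odd_merge I K \<Longrightarrow> 0 \<notin> set I"
  by (induction rule: odd_merge.induct) auto

lemma odd_merge_odd: "odd_merge I K \<Longrightarrow> \<forall>k\<in>set K. odd (wt k)"
  by (induction rule: odd_merge.induct) auto

lemma odd_merge_map_wt:
  "odd_merge I K \<Longrightarrow> map wt I = concat (map (\<lambda>k. replicate (wt k div 2) 2 @ [1]) K)"
  by (induction rule: odd_merge.induct) auto

lemma Pk_Cons_one: "wt i = 1 \<Longrightarrow> Pk (i # I) = Suc ` Pk I"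
  by (simp add: Pk_Cons)

lemma Pk_Cons_two: "wt i = 2 \<Longrightarrow> I \<noteq> [] \<Longrightarrow> Pk (i # I) = insert 2 ((+) 2 ` Pk I)"
  by (simp add: Pk_Cons)

lemma peak_subset_image_Suc: "peak_subset n S \<Longrightarrow> peak_subset (Suc n) (Suc ` S)"
  unfolding peak_subset_def by fastforce

lemma peak_subset_insert_2:
  "peak_subset n S \<Longrightarrow> n > 0 \<Longrightarrow> peak_subset (n + 2) (insert 2 ((+) 2 ` S))"
  unfolding peak_subset_def by fastforce

lemma odd_merge_peak_subset: "odd_merge I K \<Longrightarrow> peak_subset (wt (sum_list I)) (Pk I)"
proof (induction rule: odd_merge.induct)
  case (one i I K)
  then show ?case
    using peak_subset_image_Suc[OF one.IH] by (simp add: Pk_Cons_one)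
next
  case (two i I k K)
  have "I \<noteq> []" "0 \<notin> set I"
    using two.hyps odd_merge_Nil_iff odd_merge_nonzero by blast+
  then have "wt (sum_list I) > 0"
    using length_le_wt_sum_list[of I] by (cases I) auto
  then show ?case
    using peak_subset_insert_2[OF two.IH] two.hyps(1) \<open>I \<noteq> []\<close> by (simp add: Pk_Cons_two)
qed (simp add: peak_subset_def)

lemma odd_merge_Pk_ge_2: "odd_merge I K \<Longrightarrow> s \<in> Pk I \<Longrightarrow> s \<ge> 2"
  using odd_merge_peak_subset[of I K] by (auto simp: peak_subset_def)

lemma odd_merge_D_iff:
  assumes "odd_merge I K" "0 < d" "d < wt (sum_list I)"
  shows "d \<in> D I \<longleftrightarrow> Suc d \<notin> Pk I"
  using assms
proof (induction arbitrary: d rule: odd_merge.induct)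
  case (one i I K)
  then obtain e where d_eq: "d = Suc e"
    by (cases d) auto
  have "I \<noteq> []"
    using one by auto
  have "1 \<notin> Pk I"
    using odd_merge_Pk_ge_2[OF one.hyps(2), of 1] by auto
  moreover have "e \<in> D I \<longleftrightarrow> Suc e \<notin> Pk I" if "e > 0"
    using one d_eq that by auto
  ultimately show ?case
    using d_eq one.hyps(1) \<open>I \<noteq> []\<close> by (cases "e = 0") (auto simp: D_Cons Pk_Cons_one)
next
  case (two i I k K)
  have "I \<noteq> []"
    using two.hyps(2) odd_merge_Nil_iff by blast
  have shift: "D (i # I) = insert 2 ((+) 2 ` D I)" "Pk (i # I) = insert 2 ((+) 2 ` Pk I)"
    using two.hyps(1) \<open>I \<noteq> []\<close> by (simp_all add: D_Cons Pk_Cons_two)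
  show ?case
  proof (cases "d \<le> 2")
    case True
    then have "d = 1 \<or> d = 2"
      using two.prems(1) by auto
    then show ?thesis
      unfolding shift using odd_merge_Pk_ge_2[OF two.hyps(2), of 1] by auto
  next
    case False
    then obtain e where "d = 2 + e" "e > 0"
      using less_imp_add_positive[of 2 d] by auto
    then have "e \<in> D I \<longleftrightarrow> Suc e \<notin> Pk I"
      using two by auto
    with \<open>d = 2 + e\<close> \<open>e > 0\<close> show ?thesis
      unfolding shift by auto
  qed
qed simp

lemma odd_merge_D: "odd_merge I K \<Longrightarrow> D K = D I - Pk I"
proof (induction rule: odd_merge.induct)
  case (one i I K)
  have "0 \<notin> Pk I"
    using odd_merge_Pk_ge_2[OF one.hyps(2)] by fastforce
  then show ?case
    using one odd_merge_Nil_iff[OF one.hyps(2)] by (auto simp: D_Cons Pk_Cons_one)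
next
  case (two i I k K)
  have "I \<noteq> []"
    using two.hyps(2) odd_merge_Nil_iff by blast
  have "0 \<notin> D I"
    using D_subset[OF odd_merge_nonzero[OF two.hyps(2)]] by auto
  have "D ((i + k) # K) = (+) 2 ` D (k # K)"
    using two.hyps(1) by (simp add: D_Cons image_image add.assoc)
  also have "\<dots> = (+) 2 ` D I - (+) 2 ` Pk I"
    unfolding two.IH by (intro image_set_diff) simp
  also have "\<dots> = D (i # I) - Pk (i # I)"
    using two.hyps(1) \<open>I \<noteq> []\<close> \<open>0 \<notin> D I\<close> by (auto simp: D_Cons Pk_Cons_two)
  finally show ?case .
qed simp

lemma odd_merge_coarsens_iff:
  assumes "odd_merge I K" "cw I = cw K"
  shows "J \<unlhd> K \<longleftrightarrow> J \<unlhd> E (cw K) \<and> Pk I \<inter> (D J \<union> Suc ` D J) = {}"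
proof -
  have "0 \<notin> set K"
    using odd_merge_odd[OF assms(1)] by auto
  then have K_coarsens: "K \<unlhd> E (cw K)"
    by (rule coarsens_E_cw)
  have "D J \<subseteq> D K \<longleftrightarrow> Pk I \<inter> (D J \<union> Suc ` D J) = {}" if J_coarsens: "J \<unlhd> E (cw K)"
  proof -
    have "wt (sum_list J) = wt (sum_list I)"
      using coarsens_sum_list[OF J_coarsens] coarsens_sum_list[OF K_coarsens]
        odd_merge_sum_list[OF assms(1)] by simp
    then have "D J \<subseteq> {0<..<wt (sum_list I)}"
      using D_subset[of J] coarsens_nonzero[OF J_coarsens zero_notin_E] by simp
    then have "d \<in> D K \<longleftrightarrow> d \<notin> Pk I \<and> Suc d \<notin> Pk I" if "d \<in> D J" for d
      unfolding odd_merge_D[OF assms(1)] using odd_merge_D_iff[OF assms(1), of d] that by auto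
    then show ?thesis
      by blast
  qed
  moreover have "J \<unlhd> K \<longleftrightarrow> J \<unlhd> E (cw K) \<and> D J \<subseteq> D K"
    using coarsens_trans[OF _ K_coarsens, of J]
      coarsens_iff_D_subset[OF zero_notin_E _ K_coarsens, of J] by metis
  ultimately show ?thesis
    by metis
qed

lemma is_tilde_unique: "is_tilde K I \<Longrightarrow> is_tilde K J \<Longrightarrow> I = J"
  by (rule eq_if_cw_eq_wt_eq) (auto simp: is_tilde_iff dest!: odd_merge_map_wt)

lemma tilde_eqI: "is_tilde K I \<Longrightarrow> tilde K = I"
  unfolding tilde_def using is_tilde_unique by blast

lemma is_peak_comp_D:
  assumes "is_peak_comp S u I"
  shows "I \<unlhd> E u" "d \<in> D I \<longleftrightarrow> 0 < d \<and> d < length u \<and> Suc d \<notin> S"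
proof -
  have merge: "odd_merge I (odd_comp I)" "cw I = u" "Pk I = S"
    using assms by (auto simp: is_peak_comp_iff)
  have "0 \<notin> set I"
    using merge(1) by (rule odd_merge_nonzero)
  from coarsens_E_cw[OF this] show "I \<unlhd> E u"
    by (simp add: merge(2))
  have "wt (sum_list I) = length u"
    using length_cw[of I] merge(2) by simp
  then show "d \<in> D I \<longleftrightarrow> 0 < d \<and> d < length u \<and> Suc d \<notin> S"
    using D_subset[OF \<open>0 \<notin> set I\<close>] odd_merge_D_iff[OF merge(1), of d] merge(3) by auto
qed

lemma is_peak_comp_unique:
  assumes "is_peak_comp S u I" "is_peak_comp S u J"
  shows "I = J"
proof -
  have "D I = D J"
    using is_peak_comp_D(2)[OF assms(1)] is_peak_comp_D(2)[OF assms(2)] by blast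
  then have "I \<unlhd> J" "J \<unlhd> I"
    using is_peak_comp_D(1) assms coarsens_iff_D_subset[OF zero_notin_E] by blast+
  then show ?thesis
    by (rule coarsens_antisym)
qed

lemma peak_comp_eqI: "is_peak_comp S u I \<Longrightarrow> peak_comp S u = I"
  unfolding peak_comp_def using is_peak_comp_unique by blast


section \<open>Admissible pairs\<close>

fun split_pairs :: "color_word list \<Rightarrow> color_word list" where
  "split_pairs [] = []"
| "split_pairs ([] # ws) = split_pairs ws"
| "split_pairs ([a] # ws) = [a] # split_pairs ws"
| "split_pairs ((a # b # w) # ws) = [a, b] # split_pairs (w # ws)"

lemmas split_pairs_induct = split_pairs.induct[case_names empty empty_word singleton pair]

definition peaks_of_words :: "color_word list \<Rightarrow> nat set" where
  "peaks_of_words ws = Pk (map word_vec (split_pairs ws))"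

definition odd_sorted_words :: "color_word list \<Rightarrow> bool" where
  "odd_sorted_words ws \<longleftrightarrow> (\<forall>w\<in>set ws. odd (length w) \<and> sorted w)"

lemma odd_sorted_words_Nil [simp]: "odd_sorted_words []"
  by (simp add: odd_sorted_words_def)

lemma odd_sorted_words_Cons [simp]:
  "odd_sorted_words (w # ws) \<longleftrightarrow> odd (length w) \<and> sorted w \<and> odd_sorted_words ws"
  by (auto simp: odd_sorted_words_def)

lemma concat_split_pairs: "concat (split_pairs ws) = concat ws"
  by (induction ws rule: split_pairs_induct) auto

lemma sorted_split_pairs: "\<forall>w\<in>set ws. sorted w \<Longrightarrow> \<forall>w\<in>set (split_pairs ws). sorted w"
  by (induction ws rule: split_pairs_induct) auto

lemma odd_merge_split_pairs:
  "odd_sorted_words ws \<Longrightarrow> odd_merge (map word_vec (split_pairs ws)) (map word_vec ws)"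
proof (induction ws rule: split_pairs_induct)
  case (pair a b w ws)
  then have "odd_merge (map word_vec ([a, b] # split_pairs (w # ws)))
      ((word_vec [a, b] + word_vec w) # map word_vec ws)"
    unfolding list.map by (intro odd_merge.two) auto
  then show ?case
    by (simp add: word_vec_Cons add.assoc)
qed (auto intro: odd_merge.intros)

lemma is_tilde_split_pairs:
  assumes "odd_sorted_words ws"
  shows "is_tilde (map word_vec ws) (map word_vec (split_pairs ws))"
proof -
  have "\<forall>w\<in>set ws. sorted w"
    using assms by (simp add: odd_sorted_words_def)
  then show ?thesis
    using odd_merge_split_pairs[OF assms] sorted_split_pairs[of ws]
    by (simp add: is_tilde_iff cw_map_word_vec concat_split_pairs)
qed

lemma peaks_of_words_Nil: "peaks_of_words [] = {}"
  by (simp add: peaks_of_words_def)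

lemma peaks_of_words_singleton: "peaks_of_words ([a] # ws) = Suc ` peaks_of_words ws"
  by (simp add: peaks_of_words_def Pk_Cons_one)

lemma peaks_of_words_pair:
  assumes "odd (length w)"
  shows "peaks_of_words ((a # b # w) # ws) = insert 2 ((+) 2 ` peaks_of_words (w # ws))"
proof -
  have "split_pairs (w # ws) \<noteq> []"
    using assms by (cases "w # ws" rule: split_pairs.cases) auto
  then show ?thesis
    by (simp add: peaks_of_words_def Pk_Cons_two)
qed

lemma ex_words_with_peaks_insert_pair:
  assumes "odd (length w)" "sorted (a # b # w)"
    and vs: "odd_sorted_words vs" "concat vs = concat (w # ws)"
    and "T - {2} = (+) 2 ` peaks_of_words vs"
  shows "\<exists>us. odd_sorted_words us \<and> concat us = concat ((a # b # w) # ws) \<and> peaks_of_words us = T"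
proof (cases "2 \<in> T")
  case True
  obtain v vs' where vs_eq: "vs = v # vs'"
    using vs(2) assms(1) by (cases vs) auto
  have "v \<noteq> []" "w \<noteq> []"
    using vs(1) vs_eq assms(1) by auto
  then have "hd v = hd w"
    using vs(2) vs_eq by (cases v; cases w) auto
  then have "sorted (a # b # v)"
    using assms(2) vs(1) vs_eq \<open>v \<noteq> []\<close> \<open>w \<noteq> []\<close> by (cases v; cases w) auto
  moreover have "peaks_of_words ((a # b # v) # vs') = T"
    using vs(1) vs_eq assms(5) True by (subst peaks_of_words_pair) auto
  ultimately show ?thesis
    using vs vs_eq by (intro exI[of _ "(a # b # v) # vs'"]) auto
next
  case False
  have "peaks_of_words ([a] # [b] # vs) = T"
    using assms(5) False by (simp add: peaks_of_words_singleton image_image)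
  with vs show ?thesis
    by (intro exI[of _ "[a] # [b] # vs"]) auto
qed

lemma ex_words_with_fewer_peaks:
  assumes "odd_sorted_words ws" "T \<subseteq> peaks_of_words ws"
  shows "\<exists>vs. odd_sorted_words vs \<and> concat vs = concat ws \<and> peaks_of_words vs = T"
  using assms
proof (induction ws arbitrary: T rule: split_pairs_induct)
  case empty
  then show ?case
    by (intro exI[of _ "[]"]) (simp add: peaks_of_words_Nil)
next
  case (singleton a ws)
  from singleton.prems(2) obtain T' where "T' \<subseteq> peaks_of_words ws" "T = Suc ` T'"
    unfolding peaks_of_words_singleton by (auto simp: subset_image_iff)
  moreover from this obtain vs where "odd_sorted_words vs" "concat vs = concat ws"
      "peaks_of_words vs = T'"
    using singleton.IH[of T'] singleton.prems(1) by auto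
  ultimately show ?case
    by (intro exI[of _ "[a] # vs"]) (auto simp: peaks_of_words_singleton)
next
  case (pair a b w ws)
  have w_odd_sorted: "odd (length w)" "sorted (a # b # w)"
    using pair.prems(1) by auto
  have "T - {2} \<subseteq> (+) 2 ` peaks_of_words (w # ws)"
    using pair.prems(2) unfolding peaks_of_words_pair[OF w_odd_sorted(1)] by auto
  then obtain T' where "T' \<subseteq> peaks_of_words (w # ws)" "T - {2} = (+) 2 ` T'"
    by (auto simp: subset_image_iff)
  moreover from this obtain vs where "odd_sorted_words vs" "concat vs = concat (w # ws)"
      "peaks_of_words vs = T'"
    using pair.IH[of T'] pair.prems(1) by auto
  ultimately show ?case
    using ex_words_with_peaks_insert_pair[OF w_odd_sorted] by blast
qed auto

definition odd_vcomps :: "nat \<Rightarrow> vcomp set" where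
  "odd_vcomps l = {I \<in> vcomps l. \<forall>i\<in>set I. odd (wt i)}"

lemma odd_vcomps_iff: "K \<in> odd_vcomps l \<longleftrightarrow> (\<forall>k\<in>set K. odd (wt k)) \<and> set (cw K) \<subseteq> {..<l}"
  by (auto simp: odd_vcomps_def vcomps_iff set_cw)

lemma odd_vcomps_words:
  assumes "K \<in> odd_vcomps l"
  obtains ws where "odd_sorted_words ws" "K = map word_vec ws"
    "tilde K = map word_vec (split_pairs ws)"
proof
  let ?ws = "map column_word K"
  show "K = map word_vec ?ws"
    by (simp add: map_idI)
  show "odd_sorted_words ?ws"
    using assms by (auto simp: odd_sorted_words_def odd_vcomps_def sorted_column_word)
  then show "tilde K = map word_vec (split_pairs ?ws)"
    using is_tilde_split_pairs[of ?ws] \<open>K = map word_vec ?ws\<close> tilde_eqI by metis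
qed

lemma is_tilde_tilde: "K \<in> odd_vcomps l \<Longrightarrow> is_tilde K (tilde K)"
  using odd_vcomps_words is_tilde_split_pairs by metis

lemma ex_odd_vcomps_fewer_peaks:
  assumes "K \<in> odd_vcomps l" "T \<subseteq> Pk (tilde K)"
  shows "\<exists>L\<in>odd_vcomps l. cw L = cw K \<and> Pk (tilde L) = T"
proof -
  from assms(1) obtain ws where ws: "odd_sorted_words ws" "K = map word_vec ws"
    "tilde K = map word_vec (split_pairs ws)"
    by (rule odd_vcomps_words)
  with assms(2) obtain vs where vs: "odd_sorted_words vs" "concat vs = concat ws"
    "peaks_of_words vs = T"
    using ex_words_with_fewer_peaks[of ws T] by (auto simp: peaks_of_words_def)
  have "cw (map word_vec vs) = cw K"
    using ws(1,2) vs(1,2) by (simp add: cw_map_word_vec odd_sorted_words_def)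
  moreover have "map word_vec vs \<in> odd_vcomps l"
    using assms(1) vs(1) calculation by (simp add: odd_vcomps_iff odd_sorted_words_def)
  moreover have "Pk (tilde (map word_vec vs)) = T"
    using tilde_eqI[OF is_tilde_split_pairs[OF vs(1)]] vs(3) by (simp add: peaks_of_words_def)
  ultimately show ?thesis
    by blast
qed

abbreviation odd_peak_comp :: "nat set \<Rightarrow> color_word \<Rightarrow> vcomp" where
  "odd_peak_comp S u \<equiv> odd_comp (peak_comp S u)"

lemma odd_peak_comp_tilde:
  assumes "K \<in> odd_vcomps l"
  shows "is_peak_comp (Pk (tilde K)) (cw K) (tilde K)" "odd_peak_comp (Pk (tilde K)) (cw K) = K"
proof -
  have "odd_merge (tilde K) K" "cw (tilde K) = cw K"
    using is_tilde_tilde[OF assms] by (auto simp: is_tilde_iff)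
  then show peak: "is_peak_comp (Pk (tilde K)) (cw K) (tilde K)"
    by (simp add: is_peak_comp_iff odd_merge_odd_comp)
  show "odd_peak_comp (Pk (tilde K)) (cw K) = K"
    using peak_comp_eqI[OF peak] odd_merge_odd_comp \<open>odd_merge (tilde K) K\<close> by simp
qed

lemma admissible_eq: "admissible l = (\<lambda>K. (Pk (tilde K), cw K)) ` odd_vcomps l"
proof (intro equalityI subsetI)
  fix x assume "x \<in> admissible l"
  then obtain S u I where x_eq: "x = (S, u)" and peak: "is_peak_comp S u I"
    and word: "set u \<subseteq> {..<l}" "cw (odd_peak_comp S u) = u"
    unfolding admissible_def by blast
  have merge: "odd_merge I (odd_comp I)" "cw (odd_comp I) = u" "cw I = u" "Pk I = S"
    using peak word(2) peak_comp_eqI[OF peak] by (simp_all add: is_peak_comp_iff)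
  then have "odd_comp I \<in> odd_vcomps l" "tilde (odd_comp I) = I"
    using odd_merge_odd[OF merge(1)] word(1) tilde_eqI[of "odd_comp I" I]
    by (simp_all add: odd_vcomps_iff is_tilde_iff)
  then show "x \<in> (\<lambda>K. (Pk (tilde K), cw K)) ` odd_vcomps l"
    using x_eq merge by (intro image_eqI[of _ _ "odd_comp I"]) simp_all
next
  fix x assume "x \<in> (\<lambda>K. (Pk (tilde K), cw K)) ` odd_vcomps l"
  then obtain K where K_mem: "K \<in> odd_vcomps l" "x = (Pk (tilde K), cw K)"
    by blast
  then have "odd_merge (tilde K) K" "cw (tilde K) = cw K"
    using is_tilde_tilde by (auto simp: is_tilde_iff)
  then have "peak_subset (length (cw K)) (Pk (tilde K))"
    using odd_merge_peak_subset[of "tilde K" K] length_cw[of "tilde K"] by simp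
  moreover have "set (cw K) \<subseteq> {..<l}"
    using K_mem(1) by (simp add: odd_vcomps_iff)
  ultimately show "x \<in> admissible l"
    unfolding K_mem(2) admissible_def using odd_peak_comp_tilde[OF K_mem(1)] by auto
qed

lemma
  assumes "(S, u) \<in> admissible l" "T \<subseteq> S"
  shows admissible_subset: "(T, u) \<in> admissible l"
    and odd_peak_comp_in_odd_vcomps: "odd_peak_comp T u \<in> odd_vcomps l"
    and cw_odd_peak_comp: "cw (odd_peak_comp T u) = u"
    and Pk_tilde_odd_peak_comp: "Pk (tilde (odd_peak_comp T u)) = T"
proof -
  from assms(1) obtain K where "K \<in> odd_vcomps l" "S = Pk (tilde K)" "u = cw K"
    unfolding admissible_eq by blast
  with assms(2) obtain L where L_mem: "L \<in> odd_vcomps l" "cw L = u" "Pk (tilde L) = T"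
    using ex_odd_vcomps_fewer_peaks by blast
  then show "(T, u) \<in> admissible l"
    unfolding admissible_eq by (intro image_eqI[of _ _ L]) simp_all
  have "odd_peak_comp T u = L"
    using odd_peak_comp_tilde(2)[OF L_mem(1)] L_mem(2,3) by simp
  with L_mem show "odd_peak_comp T u \<in> odd_vcomps l" "cw (odd_peak_comp T u) = u"
      "Pk (tilde (odd_peak_comp T u)) = T"
    by simp_all
qed


section \<open>Peak functions\<close>

lemma sum_fun_apply: "(\<Sum>a\<in>X. f a) x = (\<Sum>a\<in>X. f a x :: 'b :: comm_monoid_add)"
  by (induction X rule: infinite_finite_induct) auto

definition eta_avoiding :: "nat set \<Rightarrow> color_word \<Rightarrow> series" where
  "eta_avoiding S u =
    (\<Sum>J | J \<unlhd> E u \<and> S \<inter> (D J \<union> Suc ` D J) = {}. scl (2 ^ length J) (M J))"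

lemma eta_eq_eta_avoiding:
  assumes "K \<in> odd_vcomps l"
  shows "eta K = eta_avoiding (Pk (tilde K)) (cw K)"
proof -
  have "odd_merge (tilde K) K" "cw (tilde K) = cw K"
    using is_tilde_tilde[OF assms] by (simp_all add: is_tilde_iff)
  note coarsens_iff = odd_merge_coarsens_iff[OF this]
  show ?thesis
    unfolding eta_def eta_avoiding_def coarsens_iff ..
qed

lemma
  assumes "finite S"
  shows eta_avoiding_eq_sum_theta:
      "eta_avoiding S u = (\<Sum>T\<in>Pow S. scl ((- 1) ^ card T) (theta T u))"
    and theta_eq_sum_eta_avoiding:
      "theta S u = (\<Sum>T\<in>Pow S. scl ((- 1) ^ card T) (eta_avoiding T u))"
proof -
  have sieve: "eta_avoiding T u m = (\<Sum>R\<in>Pow T. (- 1) ^ card R * theta R u m)" if "finite T" for T m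
    using sum_disjoint_eq_sum_Pow[OF finite_coarsens[of "E u"] that,
        of "\<lambda>J. 2 ^ length J * M J m" "\<lambda>J. D J \<union> Suc ` D J"]
    by (simp add: eta_avoiding_def theta_def sum_fun_apply scl_def)
  show "eta_avoiding S u = (\<Sum>T\<in>Pow S. scl ((- 1) ^ card T) (theta T u))"
    using sieve[OF assms] by (simp add: fun_eq_iff sum_fun_apply scl_def)
  have "theta S u m = (\<Sum>T\<in>Pow S. (- 1) ^ card T * eta_avoiding T u m)" for m
    using sieve by (rule inclusion_exclusion_symmetric[OF _ assms])
  then show "theta S u = (\<Sum>T\<in>Pow S. scl ((- 1) ^ card T) (eta_avoiding T u))"
    by (simp add: fun_eq_iff sum_fun_apply scl_def)
qed

lemma finite_Pk [simp]: "finite (Pk I)"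
  by (rule finite_subset[of _ "partial_wt I ` {..<length I}"]) (auto simp: Pk_def)

lemma admissible_finite: "(S, u) \<in> admissible l \<Longrightarrow> finite S"
  by (auto simp: admissible_eq)

lemma eta_eq_sum_theta:
  assumes "K \<in> odd_vcomps l"
  shows "eta K = (\<Sum>S\<in>Pow (Pk (tilde K)). scl ((- 1) ^ card S) (theta S (cw K)))"
  unfolding eta_eq_eta_avoiding[OF assms] by (rule eta_avoiding_eq_sum_theta) simp

lemma theta_eq_sum_eta:
  assumes "(S, u) \<in> admissible l"
  shows "theta S u = (\<Sum>T\<in>Pow S. scl ((- 1) ^ card T) (eta (odd_peak_comp T u)))"
proof -
  have "eta (odd_peak_comp T u) = eta_avoiding T u" if "T \<subseteq> S" for T
    using eta_eq_eta_avoiding[OF odd_peak_comp_in_odd_vcomps[OF assms that]]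
    by (simp only: cw_odd_peak_comp[OF assms that] Pk_tilde_odd_peak_comp[OF assms that])
  then show ?thesis
    unfolding theta_eq_sum_eta_avoiding[OF admissible_finite[OF assms]] by (intro sum.cong) auto
qed


section \<open>Linear extension of functions on the monomial basis\<close>

lemma linear_M_coeff: "Vector_Spaces.linear scl (*) (\<lambda>h. M_coeff h I)"
  by unfold_locales (auto simp: M_coeff_def scl_def algebra_simps)

lemma M_coeff_add [simp]: "M_coeff (f + g) I = M_coeff f I + M_coeff g I"
  and M_coeff_diff [simp]: "M_coeff (f - g) I = M_coeff f I - M_coeff g I"
  and M_coeff_scl [simp]: "M_coeff (scl a f) I = a * M_coeff f I"
  and M_coeff_zero [simp]: "M_coeff 0 I = 0"
  by (simp_all add: M_coeff_def scl_def)

lemma M_coeff_sum: "M_coeff (sum f A) I = (\<Sum>a\<in>A. M_coeff (f a) I)"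
  by (simp add: M_coeff_def sum_fun_apply)

lemma M_coeff_sum_M:
  assumes "finite F" "\<forall>I\<in>F. 0 \<notin> set I" "0 \<notin> set J"
  shows "M_coeff (\<Sum>I\<in>F. scl (c I) (M I)) J = (if J \<in> F then c J else 0)"
proof -
  have "M_coeff (\<Sum>I\<in>F. scl (c I) (M I)) J = (\<Sum>I\<in>F. if I = J then c I else 0)"
    unfolding M_coeff_sum using assms by (intro sum.cong) (auto simp: M_coeff_M)
  then show ?thesis
    using assms(1) by simp
qed

lemma M_supp_nonzero: "I \<in> M_supp h \<Longrightarrow> 0 \<notin> set I"
  by (simp add: M_supp_def)

lemma M_supp_add_subset: "M_supp (f + g) \<subseteq> M_supp f \<union> M_supp g"
  and M_supp_scl_subset: "M_supp (scl a f) \<subseteq> M_supp f"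
  by (auto simp: M_supp_def)

lemma span_M:
  assumes "h \<in> fs.span (M ` X)" "\<forall>I\<in>X. 0 \<notin> set I"
  shows "finite (M_supp h)" "M_supp h \<subseteq> X" "h = (\<Sum>I\<in>M_supp h. scl (M_coeff h I) (M I))"
proof -
  obtain V c where combination: "finite V" "V \<subseteq> M ` X" "h = (\<Sum>v\<in>V. scl (c v) v)"
    using assms(1) unfolding fs.span_explicit by blast
  from combination(2) obtain F where reindex: "F \<subseteq> X" "inj_on M F" "V = M ` F"
    by (meson subset_image_inj)
  then have h_eq: "finite F" "h = (\<Sum>I\<in>F. scl (c (M I)) (M I))"
    using combination reindex by (simp_all add: finite_image_iff sum.reindex)
  have F_nonzero: "\<forall>I\<in>F. 0 \<notin> set I"
    using reindex(1) assms(2) by blast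
  have coeff: "M_coeff h J = (if J \<in> F then c (M J) else 0)" if "0 \<notin> set J" for J
    unfolding h_eq(2) by (rule M_coeff_sum_M[OF h_eq(1) F_nonzero that])
  then have supp: "M_supp h = {J \<in> F. c (M J) \<noteq> 0}"
    using F_nonzero by (auto simp: M_supp_def split: if_splits)
  then show "finite (M_supp h)" "M_supp h \<subseteq> X"
    using h_eq(1) reindex(1) by auto
  have "(\<Sum>I\<in>M_supp h. scl (M_coeff h I) (M I)) = (\<Sum>I\<in>F. scl (c (M I)) (M I))"
    using h_eq(1) F_nonzero coeff unfolding supp by (intro sum.mono_neutral_cong_left) auto
  then show "h = (\<Sum>I\<in>M_supp h. scl (M_coeff h I) (M I))"
    using h_eq(2) by simp
qed

lemma vcomps_nonzero: "I \<in> vcomps l \<Longrightarrow> 0 \<notin> set I"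
  by (simp add: vcomps_iff)

lemma
  assumes "h \<in> QSym l"
  shows QSym_finite_M_supp: "finite (M_supp h)"
    and QSym_M_supp_subset: "M_supp h \<subseteq> vcomps l"
    and QSym_M_expansion: "h = (\<Sum>I\<in>M_supp h. scl (M_coeff h I) (M I))"
  by (rule span_M[OF assms[unfolded QSym_def]], simp add: vcomps_nonzero)+

lemma QSym_eqI:
  assumes "f \<in> QSym l" "g \<in> QSym l" "\<And>I. 0 \<notin> set I \<Longrightarrow> M_coeff f I = M_coeff g I"
  shows "f = g"
proof -
  have "M_supp f = M_supp g"
    using assms(3) by (auto simp: M_supp_def)
  then have "(\<Sum>I\<in>M_supp f. scl (M_coeff f I) (M I)) = (\<Sum>I\<in>M_supp g. scl (M_coeff g I) (M I))"
    using assms(3) M_supp_nonzero by (intro sum.cong) auto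
  then show ?thesis
    unfolding QSym_M_expansion[OF assms(1), symmetric] QSym_M_expansion[OF assms(2), symmetric] .
qed

lemma subspace_QSym: "fs.subspace (QSym l)"
  by (simp add: QSym_def)

lemma M_in_QSym: "I \<in> vcomps l \<Longrightarrow> M I \<in> QSym l"
  by (auto simp: QSym_def intro: fs.span_base)

text \<open>
  Outside \<open>QSym\<close> the index set \<open>M_supp h\<close> may be infinite and the sum is then \<open>0\<close>, so that the
  extension is linear only on \<open>QSym\<close>.
\<close>

definition M_extend :: "(rat \<Rightarrow> 'v \<Rightarrow> 'v) \<Rightarrow> (vcomp \<Rightarrow> 'v) \<Rightarrow> series \<Rightarrow> 'v :: ab_group_add" where
  "M_extend scale \<phi> h = (\<Sum>I\<in>M_supp h. scale (M_coeff h I) (\<phi> I))"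

lemma M_functional_eq_M_extend: "M_functional \<phi> = M_extend (*) \<phi>"
  by (simp add: fun_eq_iff M_functional_def M_extend_def)

lemma coprod_eq_M_extend:
  "coprod = M_extend scl (\<lambda>I. \<Sum>k\<le>length I. tensor (M (take k I)) (M (drop k I)))"
  by (simp add: fun_eq_iff coprod_def M_extend_def)

lemma deg_part_eq_M_extend:
  "h \<in> QSym l \<Longrightarrow> deg_part n h = M_extend scl (\<lambda>I. if sum_list I = n then M I else 0) h"
  unfolding deg_part_def M_extend_def
  by (simp add: QSym_finite_M_supp sum.inter_filter if_distrib[of "scl _"] cong: if_cong)

lemma vector_space_rat: "vector_space ((*) :: rat \<Rightarrow> rat \<Rightarrow> rat)"
  by unfold_locales (simp_all add: algebra_simps)

lemma M_extend_superset:
  assumes "vector_space scale" "finite F" "M_supp h \<subseteq> F" "\<forall>I\<in>F. 0 \<notin> set I"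
  shows "M_extend scale \<phi> h = (\<Sum>I\<in>F. scale (M_coeff h I) (\<phi> I))"
proof -
  interpret vector_space scale
    by (fact assms(1))
  show ?thesis
    unfolding M_extend_def using assms
    by (intro sum.mono_neutral_left) (auto simp: M_supp_def)
qed

lemma
  assumes "vector_space scale" "f \<in> QSym l"
  shows M_extend_add: "g \<in> QSym l \<Longrightarrow> M_extend scale \<phi> (f + g) = M_extend scale \<phi> f + M_extend scale \<phi> g"
    and M_extend_scl: "M_extend scale \<phi> (scl a f) = scale a (M_extend scale \<phi> f)"
proof -
  interpret vector_space scale
    by (fact assms(1))
  have superset: "M_extend scale \<phi> h = (\<Sum>I\<in>F. scale (M_coeff h I) (\<phi> I))"
    if "finite F" "F \<subseteq> {I. 0 \<notin> set I}" "M_supp h \<subseteq> F" for F h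
    using that by (intro M_extend_superset[OF assms(1)]) auto
  have supp: "finite (M_supp h)" "M_supp h \<subseteq> {I. 0 \<notin> set I}" if "h \<in> QSym l" for h
    using that QSym_finite_M_supp M_supp_nonzero by auto
  show "M_extend scale \<phi> (f + g) = M_extend scale \<phi> f + M_extend scale \<phi> g" if "g \<in> QSym l"
    using supp[OF assms(2)] supp[OF that] M_supp_add_subset[of f g]
    by (simp add: superset[of "M_supp f \<union> M_supp g"] scale_left_distrib sum.distrib)
  show "M_extend scale \<phi> (scl a f) = scale a (M_extend scale \<phi> f)"
    using supp[OF assms(2)] M_supp_scl_subset[of a f]
    by (simp add: superset[of "M_supp f"] scale_sum_right)
qed

lemma subspace_M_extend_vimage:
  assumes "vector_space scale" "module.subspace scale V"
  shows "fs.subspace {h \<in> QSym l. M_extend scale \<phi> h \<in> V}"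
proof -
  interpret vector_space scale
    by (fact assms(1))
  have "M_extend scale \<phi> 0 = 0"
    by (simp add: M_extend_def M_supp_def)
  then show ?thesis
    using assms(2) subspace_QSym[of l] M_extend_add[OF assms(1)] M_extend_scl[OF assms(1)]
    by (auto simp: fs.subspace_def subspace_def)
qed

lemma linear_on_QSym_M_functional: "linear_on_QSym l (M_functional \<phi>)"
  unfolding linear_on_QSym_def M_functional_eq_M_extend
  by (auto intro: M_extend_add M_extend_scl vector_space_rat)

lemma linear_on_QSym_eq_M_functional:
  assumes "linear_on_QSym l \<phi>" "h \<in> QSym l"
  shows "\<phi> h = M_functional (\<lambda>I. \<phi> (M I)) h"
proof -
  let ?\<psi> = "M_functional (\<lambda>I. \<phi> (M I))"
  have combination: "L (scl c f + g) = c * L f + L g"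
    if "linear_on_QSym l L" "f \<in> QSym l" "g \<in> QSym l" for L c f g
    using that fs.subspace_scale[OF subspace_QSym] by (simp add: linear_on_QSym_def)
  have zero: "L 0 = 0" if "linear_on_QSym l L" for L
    using combination[OF that, where f = 0 and g = 0 and c = "- 1"] fs.subspace_0[OF subspace_QSym]
    by simp
  from assms(2) have "h \<in> QSym l \<and> \<phi> h = ?\<psi> h"
    unfolding QSym_def
  proof (induction rule: fs.span_induct_alt)
    case base
    show ?case
      by (simp only: zero[OF assms(1)] zero[OF linear_on_QSym_M_functional] fs.span_zero)
  next
    case (step c f g)
    then obtain I where f_eq: "I \<in> vcomps l" "f = M I"
      by blast
    have QSym: "M I \<in> QSym l" "g \<in> QSym l"
      using M_in_QSym[OF f_eq(1)] step.IH by (simp_all add: QSym_def)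
    have "\<phi> (scl c f + g) = ?\<psi> (scl c f + g)"
      using combination[OF assms(1) QSym] combination[OF linear_on_QSym_M_functional QSym] step.IH
      by (simp add: f_eq(2) M_functional_M[OF vcomps_nonzero[OF f_eq(1)]])
    moreover have "scl c f + g \<in> QSym l"
      using QSym fs.subspace_add[OF subspace_QSym] fs.subspace_scale[OF subspace_QSym] f_eq(2) by blast
    ultimately show ?case
      unfolding QSym_def by blast
  qed
  then show ?thesis
    by blast
qed

lemma M_functional_cong:
  "(\<And>I. I \<in> M_supp h \<Longrightarrow> \<phi> I = \<psi> I) \<Longrightarrow> M_functional \<phi> h = M_functional \<psi> h"
  by (simp add: M_functional_def)


section \<open>Homogeneous parts\<close>

lemma
  assumes "h \<in> QSym l"
  shows M_coeff_deg_part: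
      "0 \<notin> set I \<Longrightarrow> M_coeff (deg_part n h) I = (if sum_list I = n then M_coeff h I else 0)"
    and M_supp_deg_part: "M_supp (deg_part n h) = {I \<in> M_supp h. sum_list I = n}"
proof -
  show coeff: "M_coeff (deg_part n h) I = (if sum_list I = n then M_coeff h I else 0)"
    if "0 \<notin> set I" for I
  proof -
    have "finite {I \<in> M_supp h. sum_list I = n}"
      using QSym_finite_M_supp[OF assms] by simp
    moreover have "M_coeff h I = 0" if "I \<notin> M_supp h"
      using that \<open>0 \<notin> set I\<close> by (simp add: M_supp_def)
    ultimately show ?thesis
      unfolding deg_part_def using that by (subst M_coeff_sum_M) (auto simp: M_supp_nonzero)
  qed
  show "M_supp (deg_part n h) = {I \<in> M_supp h. sum_list I = n}"
    using coeff by (auto simp: M_supp_def split: if_splits)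
qed

lemma M_functional_deg_part:
  assumes "h \<in> QSym l"
  shows "M_functional \<phi> (deg_part n h) = (\<Sum>I\<in>{I \<in> M_supp h. sum_list I = n}. M_coeff h I * \<phi> I)"
  unfolding M_functional_def M_supp_deg_part[OF assms]
  by (intro sum.cong) (auto simp: M_coeff_deg_part[OF assms] M_supp_nonzero)

lemma M_functional_deg_part_compositions:
  assumes "h \<in> QSym l"
  shows "M_functional \<phi> (deg_part n h) = (\<Sum>J\<in>compositions n. M_coeff h J * \<phi> J)"
  unfolding M_functional_deg_part[OF assms]
  by (intro sum.mono_neutral_left finite_compositions) (auto simp: compositions_def M_supp_def)

lemma deg_part_QSym_deg:
  assumes "h \<in> QSym_deg l k"
  shows "deg_part n h = (if n = k then h else 0)"
proof -
  have expansion: "M_supp h \<subseteq> {I \<in> vcomps l. sum_list I = k}"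
      "h = (\<Sum>I\<in>M_supp h. scl (M_coeff h I) (M I))"
    using span_M[of h "{I \<in> vcomps l. sum_list I = k}"] assms vcomps_nonzero
    unfolding QSym_deg_def by blast+
  from expansion(1) have "{I \<in> M_supp h. sum_list I = n} = (if n = k then M_supp h else {})"
    by auto
  with expansion(2) show ?thesis
    by (simp add: deg_part_def)
qed

lemma deg_part_in_graded_subcoalgebra:
  assumes "graded_subcoalgebra l C" "h \<in> C"
  shows "deg_part n h \<in> C"
proof -
  have C_graded: "fs.subspace C" "C \<subseteq> QSym l" "C = fs.span (\<Union>k. C \<inter> QSym_deg l k)"
    using assms(1) unfolding graded_subcoalgebra_def by blast+
  let ?L = "M_extend scl (\<lambda>I. if sum_list I = n then M I else 0)"
  have "fs.span (\<Union>k. C \<inter> QSym_deg l k) \<subseteq> {h \<in> QSym l. ?L h \<in> C}"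
  proof (intro fs.span_minimal subspace_M_extend_vimage fs.vector_space_axioms C_graded(1) subsetI)
    fix f assume "f \<in> (\<Union>k. C \<inter> QSym_deg l k)"
    then obtain k where f_homogeneous: "f \<in> C" "f \<in> QSym_deg l k"
      by blast
    have "f \<in> QSym l" "deg_part n f \<in> C"
      using f_homogeneous C_graded(1,2) by (auto simp: deg_part_QSym_deg fs.subspace_0)
    then show "f \<in> {h \<in> QSym l. ?L h \<in> C}"
      by (simp add: deg_part_eq_M_extend)
  qed
  then show ?thesis
    using C_graded(2,3) assms(2) deg_part_eq_M_extend
    by (metis (no_types, lifting) mem_Collect_eq subsetD)
qed


section \<open>The functional zeta and its inverse\<close>

lemma zetaQ_M: "0 \<notin> set I \<Longrightarrow> zetaQ (M I) = (if length I \<le> 1 then 1 else 0)"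
  by (simp add: zetaQ_def M_functional_M)

lemma conv_M:
  "0 \<notin> set I \<Longrightarrow> conv f g (M I) = (\<Sum>k\<le>length I. f (M (take k I)) * g (M (drop k I)))"
  by (simp add: conv_def M_functional_M)

lemma counit_M: "0 \<notin> set I \<Longrightarrow> counit (M I) = (if I = [] then 1 else 0)"
  by (simp add: counit_def M_functional_M)

lemma sum_zetaQ_take:
  assumes "0 \<notin> set I"
  shows "(\<Sum>k\<le>length I. zetaQ (M (take k I)) * g k) = g 0 + (if I = [] then 0 else g 1)"
proof -
  have "zetaQ (M (take k I)) = (if k \<le> 1 then 1 else 0)" if "k \<le> length I" for k
    using assms that by (subst zetaQ_M) (auto dest: in_set_takeD)
  then have "(\<Sum>k\<le>length I. zetaQ (M (take k I)) * g k) = (\<Sum>k\<in>{..length I} \<inter> {0, 1}. g k)"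
    unfolding sum.inter_restrict[OF finite_atMost] by (intro sum.cong) auto
  also have "{..length I} \<inter> {0, 1} = (if I = [] then {0} else {0, 1})"
    by (cases I) auto
  finally show ?thesis
    by simp
qed

lemma sum_zetaQ_drop:
  assumes "0 \<notin> set I"
  shows "(\<Sum>k\<le>length I. g k * zetaQ (M (drop k I))) =
    g (length I) + (if I = [] then 0 else g (length I - 1))"
proof -
  have "zetaQ (M (drop k I)) = (if length I - k \<le> 1 then 1 else 0)" if "k \<le> length I" for k
    using assms that by (subst zetaQ_M) (auto dest: in_set_dropD)
  then have "(\<Sum>k\<le>length I. g k * zetaQ (M (drop k I))) =
      (\<Sum>k\<in>{..length I} \<inter> {length I, length I - 1}. g k)"
    unfolding sum.inter_restrict[OF finite_atMost] by (intro sum.cong) auto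
  also have "{..length I} \<inter> {length I, length I - 1} = {length I, length I - 1}"
    by auto
  finally show ?thesis
    by (cases I) auto
qed

lemma conv_inverse_zetaQ: "conv_inverse l zetaQ (M_functional (\<lambda>I. (- 1) ^ length I))"
proof -
  let ?sign = "M_functional (\<lambda>I. (- 1) ^ length I)"
  have sign_values: "?sign (M (take k I)) = (- 1) ^ min k (length I)"
      "?sign (M (drop k I)) = (- 1) ^ (length I - k)" if "0 \<notin> set I" for k I
  proof -
    have "0 \<notin> set (take k I)" "0 \<notin> set (drop k I)"
      using that in_set_takeD in_set_dropD by metis+
    then show "?sign (M (take k I)) = (- 1) ^ min k (length I)"
        "?sign (M (drop k I)) = (- 1) ^ (length I - k)"
      by (simp_all add: M_functional_M min.commute)
  qed
  have "conv zetaQ ?sign h = counit h" "conv ?sign zetaQ h = counit h" for h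
    unfolding conv_def counit_def
  proof (safe intro!: M_functional_cong)
    fix I assume "I \<in> M_supp h"
    then have nonzero: "0 \<notin> set I"
      by (rule M_supp_nonzero)
    show "(\<Sum>k\<le>length I. zetaQ (M (take k I)) * ?sign (M (drop k I))) = (if I = [] then 1 else 0)"
      unfolding sign_values[OF nonzero] sum_zetaQ_take[OF nonzero] by (cases I) simp_all
    show "(\<Sum>k\<le>length I. ?sign (M (take k I)) * zetaQ (M (drop k I))) = (if I = [] then 1 else 0)"
      unfolding sign_values[OF nonzero] sum_zetaQ_drop[OF nonzero] by (cases I) simp_all
  qed
  then show ?thesis
    by (simp add: conv_inverse_def linear_on_QSym_M_functional)
qed

lemma conv_inverse_zetaQ_M:
  assumes "conv_inverse l zetaQ g" "I \<in> vcomps l"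
  shows "g (M I) = (- 1) ^ length I"
  using assms(2)
proof (induction I)
  case Nil
  then have "conv zetaQ g (M []) = counit (M [])"
    using assms(1) M_in_QSym by (auto simp: conv_inverse_def)
  then show ?case
    by (simp add: conv_M zetaQ_M counit_M)
next
  case (Cons i I)
  have "0 \<notin> set (i # I)" "I \<in> vcomps l"
    using Cons.prems by (auto simp: vcomps_def)
  moreover have "conv zetaQ g (M (i # I)) = counit (M (i # I))"
    using assms(1) M_in_QSym[OF Cons.prems] by (auto simp: conv_inverse_def)
  ultimately show ?case
    using Cons.IH sum_zetaQ_take[of "i # I" "\<lambda>k. g (M (drop k (i # I)))"]
    by (simp add: conv_M counit_M del: sum.atMost_Suc)
qed

lemma zetaQ_inv_eq:
  assumes "h \<in> QSym l"
  shows "zetaQ_inv l h = M_functional (\<lambda>I. (- 1) ^ length I) h"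
proof -
  have inv: "conv_inverse l zetaQ (zetaQ_inv l)"
    unfolding zetaQ_inv_def by (rule someI[of "conv_inverse l zetaQ", OF conv_inverse_zetaQ])
  then have "zetaQ_inv l h = M_functional (\<lambda>I. zetaQ_inv l (M I)) h"
    by (intro linear_on_QSym_eq_M_functional[OF _ assms]) (simp add: conv_inverse_def)
  also have "\<dots> = M_functional (\<lambda>I. (- 1) ^ length I) h"
    using conv_inverse_zetaQ_M[OF inv] QSym_M_supp_subset[OF assms] by (intro M_functional_cong) blast
  finally show ?thesis .
qed

lemma zetaQ_bar_eq:
  assumes "h \<in> QSym l"
  shows "zetaQ_bar h = M_functional (\<lambda>I. if length I \<le> 1 then (- 1) ^ wt (sum_list I) else 0) h"
proof -
  have "zetaQ_bar h = (\<Sum>n\<in>sum_list ` M_supp h. \<Sum>I\<in>{I \<in> M_supp h. sum_list I = n}.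
      M_coeff h I * (if length I \<le> 1 then (- 1) ^ wt (sum_list I) else 0))"
    unfolding zetaQ_bar_def zetaQ_def M_functional_deg_part[OF assms]
    by (auto simp: sum_distrib_left intro!: sum.cong)
  also have "\<dots> = M_functional (\<lambda>I. if length I \<le> 1 then (- 1) ^ wt (sum_list I) else 0) h"
    unfolding M_functional_def using QSym_finite_M_supp[OF assms] by (rule sum.image_gen[symmetric])
  finally show ?thesis .
qed


section \<open>The coalgebra spanned by the odd eta functions\<close>

lemma M_coeff_eta:
  assumes "0 \<notin> set I" "0 \<notin> set J"
  shows "M_coeff (eta I) J = (if J \<unlhd> I then 2 ^ length J else 0)"
  unfolding eta_def
  by (subst M_coeff_sum_M) (use assms coarsens_nonzero in auto)

lemma M_supp_eta: "0 \<notin> set I \<Longrightarrow> M_supp (eta I) = {J. J \<unlhd> I}"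
  using coarsens_nonzero by (auto simp: M_supp_def M_coeff_eta split: if_splits)

lemma M_extend_eta:
  assumes "0 \<notin> set I"
  shows "M_extend scale \<phi> (eta I) = (\<Sum>J | J \<unlhd> I. scale (2 ^ length J) (\<phi> J))"
  unfolding M_extend_def M_supp_eta[OF assms]
  by (intro sum.cong) (use assms coarsens_nonzero in \<open>auto simp: M_coeff_eta\<close>)

lemma eta_in_QSym_deg:
  assumes "I \<in> vcomps l"
  shows "eta I \<in> QSym_deg l (sum_list I)"
  unfolding eta_def QSym_deg_def
  by (intro fs.span_sum fs.span_scale fs.span_base imageI)
    (use assms coarsens_vcomps coarsens_sum_list in auto)

lemma eta_in_QSym: "I \<in> vcomps l \<Longrightarrow> eta I \<in> QSym l"
  unfolding eta_def QSym_def
  by (intro fs.span_sum fs.span_scale fs.span_base imageI) (auto intro: coarsens_vcomps)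

lemma tensor_eta:
  "tensor (eta A) (eta B) =
    (\<Sum>(J1, J2)\<in>{J. J \<unlhd> A} \<times> {J. J \<unlhd> B}. scl (2 ^ length (J1 @ J2)) (tensor (M J1) (M J2)))"
proof
  fix pq :: "xmonom \<times> xmonom"
  obtain p q where pq_eq: "pq = (p, q)"
    by fastforce
  show "tensor (eta A) (eta B) pq =
    (\<Sum>(J1, J2)\<in>{J. J \<unlhd> A} \<times> {J. J \<unlhd> B}. scl (2 ^ length (J1 @ J2)) (tensor (M J1) (M J2))) pq"
    by (simp add: pq_eq tensor_def eta_def sum_fun_apply sum_product sum.cartesian_product scl_def
        case_prod_beta power_add algebra_simps)
qed

lemma coarsens_take_unique:
  assumes "0 \<notin> set I" "k \<le> length I" "k' \<le> length I" "J \<unlhd> take k I" "J \<unlhd> take k' I"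
  shows "k = k'"
proof -
  have "wt (sum_list (take k I)) = wt (sum_list (take k' I))"
    by (simp only: coarsens_sum_list[OF assms(4), symmetric] coarsens_sum_list[OF assms(5), symmetric])
  then have "take k I = take k' I"
    by (rule append_eq_append_if_wt_eq[of _ "drop k I" _ "drop k' I", rotated 2])
      (simp_all add: assms(1))
  then have "length (take k I) = length (take k' I)"
    by simp
  with assms(2,3) show ?thesis
    by simp
qed

lemma bij_betw_append_coarsens:
  assumes "0 \<notin> set I"
  shows "bij_betw (\<lambda>(k, J, K). (J @ K, length J))
    (SIGMA k:{..length I}. {J. J \<unlhd> take k I} \<times> {K. K \<unlhd> drop k I})
    (SIGMA J:{J. J \<unlhd> I}. {..length J})" (is "bij_betw ?cut ?X ?Y")
proof (rule bij_betw_imageI)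
  show "inj_on ?cut ?X"
    using coarsens_take_unique[OF assms] by (force intro!: inj_onI)
  show "?cut ` ?X = ?Y"
  proof (intro equalityI subsetI)
    fix y assume "y \<in> ?cut ` ?X"
    then obtain k J K where "y = (J @ K, length J)" "J \<unlhd> take k I" "K \<unlhd> drop k I"
      by auto
    then show "y \<in> ?Y"
      using coarsens_append[of J "take k I" K "drop k I"] by simp
  next
    fix y assume "y \<in> ?Y"
    then obtain J j where y_eq: "y = (J, j)" "J \<unlhd> I" "j \<le> length J"
      by auto
    then have "take j J @ drop j J \<unlhd> I"
      by simp
    then obtain I1 I2 where "I = I1 @ I2" "take j J \<unlhd> I1" "drop j J \<unlhd> I2"
      unfolding coarsens_append_iff by blast
    with y_eq(1,3) show "y \<in> ?cut ` ?X"
      by (intro image_eqI[of _ _ "(length I1, take j J, drop j J)"]) simp_all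
  qed
qed

lemma coprod_eta:
  assumes "0 \<notin> set I"
  shows "coprod (eta I) = (\<Sum>k\<le>length I. tensor (eta (take k I)) (eta (drop k I)))"
proof -
  let ?X = "SIGMA k:{..length I}. {J. J \<unlhd> take k I} \<times> {K. K \<unlhd> drop k I}"
  let ?Y = "SIGMA J:{J. J \<unlhd> I}. {..length J}"
  let ?cut = "\<lambda>(k :: nat, J, K). (J @ K, length J)"
  let ?g = "\<lambda>(J, j). scl (2 ^ length J) (tensor (M (take j J)) (M (drop j J)))"
  have "coprod (eta I) = (\<Sum>J | J \<unlhd> I. \<Sum>j\<le>length J. ?g (J, j))"
    unfolding coprod_eq_M_extend M_extend_eta[OF assms] by (simp only: fs.scale_sum_right prod.case)
  also have "\<dots> = (\<Sum>y\<in>?Y. ?g y)"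
    by (subst sum.Sigma) (simp_all add: case_prod_beta)
  also have "\<dots> = (\<Sum>x\<in>?X. ?g (?cut x))"
    by (rule sum.reindex_bij_betw[OF bij_betw_append_coarsens[OF assms], symmetric])
  also have "\<dots> = (\<Sum>k\<le>length I. \<Sum>z\<in>{J. J \<unlhd> take k I} \<times> {K. K \<unlhd> drop k I}. ?g (?cut (k, z)))"
    by (subst sum.Sigma) (simp_all add: case_prod_beta)
  also have "\<dots> = (\<Sum>k\<le>length I. tensor (eta (take k I)) (eta (drop k I)))"
    by (simp add: tensor_eta case_prod_beta)
  finally show ?thesis .
qed

definition eta_span :: "nat \<Rightarrow> series set" where
  "eta_span l = fs.span (eta ` odd_vcomps l)"

lemma odd_vcomps_vcomps: "I \<in> odd_vcomps l \<Longrightarrow> I \<in> vcomps l"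
  by (simp add: odd_vcomps_def)

lemma odd_vcomps_nonzero: "I \<in> odd_vcomps l \<Longrightarrow> 0 \<notin> set I"
  using odd_vcomps_vcomps vcomps_nonzero by blast

lemma odd_vcomps_append_iff:
  "I @ J \<in> odd_vcomps l \<longleftrightarrow> I \<in> odd_vcomps l \<and> J \<in> odd_vcomps l"
  by (auto simp: odd_vcomps_def vcomps_append_iff)

lemma subspace_eta_span: "fs.subspace (eta_span l)"
  by (simp add: eta_span_def)

lemma eta_in_eta_span: "I \<in> odd_vcomps l \<Longrightarrow> eta I \<in> eta_span l"
  unfolding eta_span_def by (intro fs.span_base imageI)

lemma eta_span_subsetI:
  "fs.subspace V \<Longrightarrow> (\<And>I. I \<in> odd_vcomps l \<Longrightarrow> eta I \<in> V) \<Longrightarrow> eta_span l \<subseteq> V"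
  unfolding eta_span_def by (intro fs.span_minimal) auto

lemma eta_span_subset_QSym: "eta_span l \<subseteq> QSym l"
  by (intro eta_span_subsetI subspace_QSym eta_in_QSym odd_vcomps_vcomps)

lemma eta_span_graded: "eta_span l = fs.span (\<Union>n. eta_span l \<inter> QSym_deg l n)"
proof
  show "eta_span l \<subseteq> fs.span (\<Union>n. eta_span l \<inter> QSym_deg l n)"
  proof (rule eta_span_subsetI[OF fs.subspace_span fs.span_base])
    fix I assume "I \<in> odd_vcomps l"
    then have "eta I \<in> eta_span l" "eta I \<in> QSym_deg l (sum_list I)"
      using eta_in_eta_span eta_in_QSym_deg odd_vcomps_vcomps by simp_all
    then show "eta I \<in> (\<Union>n. eta_span l \<inter> QSym_deg l n)"
      by blast
  qed
  show "fs.span (\<Union>n. eta_span l \<inter> QSym_deg l n) \<subseteq> eta_span l"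
    by (intro fs.span_minimal subspace_eta_span) auto
qed

lemma coprod_eta_span: "coprod ` eta_span l \<subseteq> tensor_square (eta_span l)"
proof -
  have subspace: "fs.subspace {h \<in> QSym l. coprod h \<in> tensor_square (eta_span l)}"
    unfolding coprod_eq_M_extend
    by (intro subspace_M_extend_vimage fs.vector_space_axioms) (simp add: tensor_square_def)
  have "coprod (eta I) \<in> tensor_square (eta_span l)" if odd: "I \<in> odd_vcomps l" for I
    unfolding coprod_eta[OF odd_vcomps_nonzero[OF odd]] tensor_square_def
  proof (intro fs.span_sum fs.span_base)
    fix k
    have "take k I \<in> odd_vcomps l" "drop k I \<in> odd_vcomps l"
      using odd odd_vcomps_append_iff[of "take k I" "drop k I"] by simp_all
    then show "tensor (eta (take k I)) (eta (drop k I)) \<in>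
        {tensor f g |f g. f \<in> eta_span l \<and> g \<in> eta_span l}"
      using eta_in_eta_span by blast
  qed
  then have "eta_span l \<subseteq> {h \<in> QSym l. coprod h \<in> tensor_square (eta_span l)}"
    using eta_in_QSym odd_vcomps_vcomps by (intro eta_span_subsetI[OF subspace]) blast
  then show ?thesis
    by blast
qed

lemma graded_subcoalgebra_eta_span: "graded_subcoalgebra l (eta_span l)"
  unfolding graded_subcoalgebra_def
  using subspace_eta_span eta_span_subset_QSym eta_span_graded coprod_eta_span by blast

lemma odd_wt_sum_list: "\<forall>i\<in>set I. odd (wt i) \<Longrightarrow> odd (wt (sum_list I)) \<longleftrightarrow> odd (length I)"
  by (induction I) auto

lemma zetaQ_bar_eta:
  assumes "I \<in> vcomps l" "I \<noteq> []"
  shows "zetaQ_bar (eta I) = 2 * (- 1) ^ wt (sum_list I)"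
proof -
  have "zetaQ_bar (eta I) =
      (\<Sum>J | J \<unlhd> I. 2 ^ length J * (if length J \<le> 1 then (- 1) ^ wt (sum_list J) else 0))"
    unfolding zetaQ_bar_eq[OF eta_in_QSym[OF assms(1)]] M_functional_eq_M_extend
      M_extend_eta[OF vcomps_nonzero[OF assms(1)]] ..
  also have "\<dots> = (\<Sum>J | J \<unlhd> I. if J = [sum_list I] then 2 * (- 1) ^ wt (sum_list I) else 0)"
  proof (intro sum.cong refl)
    fix J assume "J \<in> {J. J \<unlhd> I}"
    then have "J \<noteq> []" "sum_list J = sum_list I"
      using assms(2) coarsens_sum_list by auto
    then show "2 ^ length J * (if length J \<le> 1 then (- 1) ^ wt (sum_list J) else 0) =
        (if J = [sum_list I] then 2 * (- 1) ^ wt (sum_list I) else (0 :: rat))"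
      by (cases J) auto
  qed
  also have "\<dots> = 2 * (- 1) ^ wt (sum_list I)"
    using assms(2) by (simp add: coarsens_singleton_iff)
  finally show ?thesis .
qed

lemma zetaQ_inv_eta:
  assumes "I \<in> vcomps l" "I \<noteq> []"
  shows "zetaQ_inv l (eta I) = 2 * (- 1) ^ length I"
proof -
  have "zetaQ_inv l (eta I) = (\<Sum>J | J \<unlhd> I. (- 2) ^ length J)"
    unfolding zetaQ_inv_eq[OF eta_in_QSym[OF assms(1)]] M_functional_eq_M_extend
      M_extend_eta[OF vcomps_nonzero[OF assms(1)]]
    by (simp flip: power_mult_distrib)
  also have "\<dots> = - 2 * (1 + - 2) ^ (length I - 1)"
    using vcomps_nonzero[OF assms(1)] assms(2) by (rule sum_power_length_coarsens)
  also have "\<dots> = 2 * (- 1) ^ length I"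
    using assms(2) by (cases I) simp_all
  finally show ?thesis .
qed

lemma zetaQ_bar_eta_span:
  assumes "h \<in> eta_span l"
  shows "zetaQ_bar h = zetaQ_inv l h"
proof -
  let ?\<delta> = "\<lambda>I. (if length I \<le> 1 then (- 1) ^ wt (sum_list I) else 0) - (- 1) ^ length I"
  have diff: "zetaQ_bar f - zetaQ_inv l f = M_extend (*) ?\<delta> f" if "f \<in> QSym l" for f
    unfolding zetaQ_bar_eq[OF that] zetaQ_inv_eq[OF that] M_functional_eq_M_extend M_extend_def
    by (simp add: right_diff_distrib sum_subtractf)
  interpret rat: vector_space "(*) :: rat \<Rightarrow> rat \<Rightarrow> rat"
    by (rule vector_space_rat)
  have "zetaQ_bar (eta I) = zetaQ_inv l (eta I)" if odd: "I \<in> odd_vcomps l" for I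
  proof (cases "I = []")
    case True
    then show ?thesis
      using odd diff[of "eta I"] eta_in_QSym odd_vcomps_vcomps M_extend_eta[of "[]" "(*)" ?\<delta>] by auto
  next
    case False
    with odd show ?thesis
      using odd_wt_sum_list[of I] zetaQ_bar_eta[of I l] zetaQ_inv_eta[of I l]
      by (auto simp: odd_vcomps_def minus_one_power_iff)
  qed
  then have "eta I \<in> {f \<in> QSym l. M_extend (*) ?\<delta> f \<in> {0}}" if "I \<in> odd_vcomps l" for I
    using that diff[of "eta I"] eta_in_QSym odd_vcomps_vcomps by auto
  then have "eta_span l \<subseteq> {f \<in> QSym l. M_extend (*) ?\<delta> f \<in> {0}}"
    by (intro eta_span_subsetI subspace_M_extend_vimage vector_space_rat rat.subspace_single_0)
  with assms diff[of h] show ?thesis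
    by auto
qed


section \<open>The generalized Dehn-Sommerville relations\<close>

definition dehn_sommerville :: "series \<Rightarrow> bool" where
  "dehn_sommerville h \<longleftrightarrow> (\<forall>A B m. 0 \<notin> set A \<longrightarrow> 0 \<notin> set B \<longrightarrow> m \<noteq> 0 \<longrightarrow>
     (\<Sum>J\<in>compositions m. (- 1) ^ length J * M_coeff h (A @ J @ B)) =
     (- 1) ^ wt m * M_coeff h (A @ [m] @ B))"

lemma dehn_sommervilleD:
  assumes "dehn_sommerville h" "0 \<notin> set A" "0 \<notin> set B" "m \<noteq> 0"
  shows "(\<Sum>J\<in>compositions m. (- 1) ^ length J * M_coeff h (A @ J @ B)) =
    (- 1) ^ wt m * M_coeff h (A @ [m] @ B)"
  using assms unfolding dehn_sommerville_def by blast

lemma dehn_sommerville_diff: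
  assumes "dehn_sommerville f" "dehn_sommerville g"
  shows "dehn_sommerville (f - g)"
  unfolding dehn_sommerville_def
  by (simp add: right_diff_distrib sum_subtractf dehn_sommervilleD[OF assms(1)]
      dehn_sommervilleD[OF assms(2)] del: append_assoc)

lemma tensor_square_slices:
  assumes "fs.subspace C" "t \<in> tensor_square C"
  shows "(\<lambda>q. t (p, q)) \<in> C" "(\<lambda>q. t (q, p)) \<in> C"
proof -
  let ?S = "{t. (\<lambda>q. t (p, q)) \<in> C \<and> (\<lambda>q. t (q, p)) \<in> C}"
  have slices: "(\<lambda>q. (s + t) (p, q)) = (\<lambda>q. s (p, q)) + (\<lambda>q. t (p, q))"
    "(\<lambda>q. (s + t) (q, p)) = (\<lambda>q. s (q, p)) + (\<lambda>q. t (q, p))"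
    "(\<lambda>q. scl c t (p, q)) = scl c (\<lambda>q. t (p, q))" "(\<lambda>q. scl c t (q, p)) = scl c (\<lambda>q. t (q, p))"
    for s t :: "xmonom \<times> xmonom \<Rightarrow> rat" and c
    by (simp_all add: fun_eq_iff scl_def)
  have "fs.subspace ?S"
    using assms(1) unfolding fs.subspace_def mem_Collect_eq slices by (simp add: zero_fun_def)
  moreover have "tensor f g \<in> ?S" if "f \<in> C" "g \<in> C" for f g
  proof -
    have "(\<lambda>q. tensor f g (p, q)) = scl (f p) g" "(\<lambda>q. tensor f g (q, p)) = scl (g p) f"
      by (simp_all add: fun_eq_iff tensor_def scl_def)
    then show ?thesis
      using that fs.subspace_scale[OF assms(1)] by simp
  qed
  ultimately have "tensor_square C \<subseteq> ?S"
    unfolding tensor_square_def by (intro fs.span_minimal) auto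
  then show "(\<lambda>q. t (p, q)) \<in> C" "(\<lambda>q. t (q, p)) \<in> C"
    using assms(2) by auto
qed

lemma coprod_coeff:
  assumes "h \<in> QSym l" "0 \<notin> set A" "0 \<notin> set B"
  shows "coprod h (xmono [0..<length A] A, xmono [0..<length B] B) = M_coeff h (A @ B)"
proof -
  have "coprod h (xmono [0..<length A] A, xmono [0..<length B] B) =
    (\<Sum>I\<in>M_supp h. M_coeff h I * (\<Sum>k\<le>length I. M_coeff (M (take k I)) A * M_coeff (M (drop k I)) B))"
    by (simp add: coprod_def sum_fun_apply scl_def tensor_def M_coeff_def)
  also have "\<dots> = (\<Sum>I\<in>M_supp h. M_coeff h I * (\<Sum>k\<le>length I. if k = length A \<and> I = A @ B then 1 else 0))"
  proof (intro sum.cong refl arg_cong2[where f = "(*)"])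
    fix I k assume "I \<in> M_supp h" and k_le: "k \<in> {..length I}"
    then have "0 \<notin> set (take k I)" "0 \<notin> set (drop k I)"
      using M_supp_nonzero in_set_takeD in_set_dropD by metis+
    moreover have "take k I = A \<and> drop k I = B \<longleftrightarrow> k = length A \<and> I = A @ B"
      using k_le by (auto simp: append_eq_conv_conj)
    ultimately show "M_coeff (M (take k I)) A * M_coeff (M (drop k I)) B =
        (if k = length A \<and> I = A @ B then 1 else 0)"
      using assms by (auto simp: M_coeff_M)
  qed
  also have "\<dots> = (\<Sum>I\<in>M_supp h. if I = A @ B then M_coeff h I else 0)"
    by (intro sum.cong) auto
  also have "\<dots> = M_coeff h (A @ B)"
    using QSym_finite_M_supp[OF assms(1)] assms by (auto simp: M_supp_def)
  finally show ?thesis .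
qed

lemma subcoalgebra_contraction:
  assumes subcoalgebra: "graded_subcoalgebra l C" and "h \<in> C" "0 \<notin> set A" "0 \<notin> set B"
  obtains g where "g \<in> C" "\<And>J. 0 \<notin> set J \<Longrightarrow> M_coeff g J = M_coeff h (A @ J @ B)"
proof
  have QSym: "g \<in> QSym l" and coprod: "coprod g \<in> tensor_square C" if "g \<in> C" for g
    using subcoalgebra that unfolding graded_subcoalgebra_def by blast+
  have "fs.subspace C"
    using subcoalgebra by (simp add: graded_subcoalgebra_def)
  note slices = tensor_square_slices[OF this coprod]
  define f where "f = (\<lambda>q. coprod h (xmono [0..<length A] A, q))"
  let ?g = "\<lambda>q. coprod f (q, xmono [0..<length B] B)"
  have f_mem: "f \<in> C"
    unfolding f_def by (rule slices(1)[OF \<open>h \<in> C\<close>])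
  show "?g \<in> C"
    by (rule slices(2)[OF f_mem])
  have "M_coeff f J = M_coeff h (A @ J)" if "0 \<notin> set J" for J
    using coprod_coeff[OF QSym[OF \<open>h \<in> C\<close>] \<open>0 \<notin> set A\<close> that] by (simp add: f_def M_coeff_def)
  moreover have "M_coeff ?g J = M_coeff f (J @ B)" if "0 \<notin> set J" for J
    unfolding M_coeff_def[of ?g] by (rule coprod_coeff[OF QSym[OF f_mem] that \<open>0 \<notin> set B\<close>])
  ultimately show "M_coeff ?g J = M_coeff h (A @ J @ B)" if "0 \<notin> set J" for J
    using that \<open>0 \<notin> set B\<close> by simp
qed

lemma zetaQ_bar_eq_zetaQ_inv_deg_part_iff:
  assumes "g \<in> QSym l" "deg_part m g \<in> QSym l" "m \<noteq> 0"
  shows "zetaQ_bar (deg_part m g) = zetaQ_inv l (deg_part m g) \<longleftrightarrow>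
    (\<Sum>J\<in>compositions m. (- 1) ^ length J * M_coeff g J) = (- 1) ^ wt m * M_coeff g [m]"
proof -
  have "zetaQ_bar (deg_part m g) =
      (\<Sum>J\<in>compositions m. M_coeff g J * (if length J \<le> 1 then (- 1) ^ wt (sum_list J) else 0))"
    unfolding zetaQ_bar_eq[OF assms(2)] M_functional_deg_part_compositions[OF assms(1)] ..
  also have "\<dots> = (\<Sum>J\<in>compositions m. if J = [m] then (- 1) ^ wt m * M_coeff g [m] else 0)"
  proof (intro sum.cong refl)
    fix J assume "J \<in> compositions m"
    then show "M_coeff g J * (if length J \<le> 1 then (- 1) ^ wt (sum_list J) else 0) =
        (if J = [m] then (- 1) ^ wt m * M_coeff g [m] else 0)"
      using assms(3) by (cases J) (auto simp: compositions_def)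
  qed
  also have "\<dots> = (- 1) ^ wt m * M_coeff g [m]"
    using assms(3) finite_compositions[of m] by (simp add: compositions_def)
  finally show ?thesis
    unfolding zetaQ_inv_eq[OF assms(2)] M_functional_deg_part_compositions[OF assms(1)]
    by (auto simp: mult.commute)
qed

lemma subcoalgebra_dehn_sommerville:
  assumes subcoalgebra: "graded_subcoalgebra l C" "\<forall>h\<in>C. zetaQ_bar h = zetaQ_inv l h" and "h \<in> C"
  shows "dehn_sommerville h"
  unfolding dehn_sommerville_def
proof (intro allI impI)
  fix A B :: vcomp and m :: cvec
  assume nonzero: "0 \<notin> set A" "0 \<notin> set B" "m \<noteq> 0"
  obtain g where contraction: "g \<in> C" "\<And>J. 0 \<notin> set J \<Longrightarrow> M_coeff g J = M_coeff h (A @ J @ B)"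
    using subcoalgebra_contraction[OF subcoalgebra(1) \<open>h \<in> C\<close> nonzero(1,2)] by blast
  have "C \<subseteq> QSym l"
    using subcoalgebra(1) by (simp add: graded_subcoalgebra_def)
  moreover have "deg_part m g \<in> C"
    using subcoalgebra(1) contraction(1) by (rule deg_part_in_graded_subcoalgebra)
  ultimately have "(\<Sum>J\<in>compositions m. (- 1) ^ length J * M_coeff g J) = (- 1) ^ wt m * M_coeff g [m]"
    using zetaQ_bar_eq_zetaQ_inv_deg_part_iff[of g l m] subcoalgebra(2) contraction(1) nonzero(3)
    by blast
  moreover have "M_coeff g J = M_coeff h (A @ J @ B)" if "J \<in> compositions m" for J
    using contraction(2) that by (simp add: compositions_def)
  ultimately show "(\<Sum>J\<in>compositions m. (- 1) ^ length J * M_coeff h (A @ J @ B)) =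
      (- 1) ^ wt m * M_coeff h (A @ [m] @ B)"
    using contraction(2)[of "[m]"] nonzero(3) by simp
qed

lemma dehn_sommerville_even_column:
  assumes "dehn_sommerville h" "0 \<notin> set A" "0 \<notin> set B" "m \<noteq> 0" "even (wt m)"
  shows "2 * M_coeff h (A @ [m] @ B) =
    (\<Sum>J\<in>compositions m - {[m]}. (- 1) ^ length J * M_coeff h (A @ J @ B))"
proof -
  have "[m] \<in> compositions m"
    using assms(4) by (simp add: compositions_def)
  then show ?thesis
    using dehn_sommervilleD[OF assms(1-4)] assms(5)
    by (simp add: sum.remove[OF finite_compositions] del: append_assoc)
qed

lemma dehn_sommerville_eq_0:
  assumes "dehn_sommerville h" "\<And>J. 0 \<notin> set J \<Longrightarrow> \<forall>j\<in>set J. odd (wt j) \<Longrightarrow> M_coeff h J = 0"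
    and "0 \<notin> set I"
  shows "M_coeff h I = 0"
  using assms(3)
proof (induction "wt (sum_list I) - length I" arbitrary: I rule: less_induct)
  case less
  show ?case
  proof (cases "\<forall>j\<in>set I. odd (wt j)")
    case False
    then obtain m A B where even: "even (wt m)" and "I = A @ m # B"
      by (metis split_list)
    then have I_split: "I = A @ [m] @ B"
      by simp
    have nonzero: "0 \<notin> set A" "0 \<notin> set B" "m \<noteq> 0"
      using less.prems I_split by auto
    have "M_coeff h (A @ J @ B) = 0" if other: "J \<in> compositions m - {[m]}" for J
    proof (rule less.hyps)
      have "length J > 1"
        using other nonzero(3) by (cases J rule: remdups_adj.cases) (auto simp: compositions_def)
      moreover show "0 \<notin> set (A @ J @ B)"
        using other nonzero by (auto simp: compositions_def)
      moreover have "wt (sum_list (A @ J @ B)) = wt (sum_list I)"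
        using other by (simp add: compositions_def I_split)
      ultimately show "wt (sum_list (A @ J @ B)) - length (A @ J @ B) < wt (sum_list I) - length I"
        using length_le_wt_sum_list[of "A @ J @ B"] by (simp add: I_split)
    qed
    then show ?thesis
      using dehn_sommerville_even_column[OF assms(1) nonzero even] by (simp add: I_split)
  qed (use assms(2) less.prems in blast)
qed


section \<open>The two bases\<close>

lemma triangular_family_eta:
  "triangular_family scl (odd_vcomps l) eta (\<lambda>I h. M_coeff h I) length"
proof (intro triangular_family.intro triangular_family_axioms.intro fs.vector_space_axioms)
  fix I assume odd_I: "I \<in> odd_vcomps l"
  show "Vector_Spaces.linear scl (*) (\<lambda>h. M_coeff h I)"
    by (rule linear_M_coeff)
  show "M_coeff (eta I) I \<noteq> 0"
    using odd_vcomps_nonzero[OF odd_I] by (simp add: M_coeff_eta)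
  fix J assume odd_J: "J \<in> odd_vcomps l" and "M_coeff (eta J) I \<noteq> 0"
  then have "I \<unlhd> J"
    using odd_vcomps_nonzero[OF odd_I] odd_vcomps_nonzero[OF odd_J]
    by (simp add: M_coeff_eta split: if_splits)
  then show "I = J \<or> length I < length J"
    using coarsens_eq_if_length_le by (metis linorder_not_le)
qed

lemma inj_on_eta: "inj_on eta (odd_vcomps l)"
  by (rule triangular_family.inj_on_family[OF triangular_family_eta])

lemma independent_eta: "fs.independent (eta ` odd_vcomps l)"
  by (rule triangular_family.independent_family[OF triangular_family_eta])

lemma dehn_sommerville_in_eta_span:
  assumes "h \<in> QSym l" "dehn_sommerville h"
  shows "h \<in> eta_span l"
proof -
  interpret eta: triangular_family scl "odd_vcomps l" eta "\<lambda>I h. M_coeff h I" length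
    by (rule triangular_family_eta)
  have finite_eta: "finite {I \<in> odd_vcomps l. M_coeff (eta J) I \<noteq> 0}" if "J \<in> odd_vcomps l" for J
    using odd_vcomps_nonzero that by (intro finite_subset[OF _ finite_coarsens[of J]])
      (auto simp: M_coeff_eta split: if_splits)
  have finite_h: "finite {I \<in> odd_vcomps l. M_coeff h I \<noteq> 0}"
    using odd_vcomps_nonzero by (intro finite_subset[OF _ QSym_finite_M_supp[OF assms(1)]])
      (auto simp: M_supp_def)
  obtain s where interpolant: "s \<in> eta_span l" "\<And>I. I \<in> odd_vcomps l \<Longrightarrow> M_coeff s I = M_coeff h I"
    using eta.ex_span_coords_eq[OF finite_eta finite_h] unfolding eta_span_def by blast
  have "s \<in> QSym l"
    using interpolant(1) eta_span_subset_QSym by blast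
  have "dehn_sommerville s"
    using subcoalgebra_dehn_sommerville[OF graded_subcoalgebra_eta_span _ interpolant(1)]
      zetaQ_bar_eta_span by blast
  then have "dehn_sommerville (h - s)"
    using dehn_sommerville_diff[OF assms(2)] by blast
  moreover have "M_coeff (h - s) J = 0" if odd: "0 \<notin> set J" "\<forall>j\<in>set J. odd (wt j)" for J
  proof (cases "J \<in> vcomps l")
    case False
    then have "J \<notin> M_supp h" "J \<notin> M_supp s"
      using QSym_M_supp_subset assms(1) \<open>s \<in> QSym l\<close> by blast+
    with odd(1) show ?thesis
      by (simp add: M_supp_def)
  qed (use odd(2) interpolant(2) in \<open>simp add: odd_vcomps_def\<close>)
  ultimately have "M_coeff (h - s) I = 0" if "0 \<notin> set I" for I
    using dehn_sommerville_eq_0 that by blast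
  then have "h = s"
    by (intro QSym_eqI[OF assms(1) \<open>s \<in> QSym l\<close>]) simp
  with interpolant(1) show ?thesis
    by simp
qed

lemma O_infty_eq_eta_span: "O_infty l = eta_span l"
  unfolding O_infty_def
proof (rule Greatest_equality)
  show "graded_subcoalgebra l (eta_span l) \<and> (\<forall>h\<in>eta_span l. zetaQ_bar h = zetaQ_inv l h)"
    using graded_subcoalgebra_eta_span zetaQ_bar_eta_span by blast
next
  fix C assume subcoalgebra: "graded_subcoalgebra l C \<and> (\<forall>h\<in>C. zetaQ_bar h = zetaQ_inv l h)"
  then have "C \<subseteq> QSym l"
    by (simp add: graded_subcoalgebra_def)
  with subcoalgebra show "C \<subseteq> eta_span l"
    using subcoalgebra_dehn_sommerville dehn_sommerville_in_eta_span by blast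
qed

lemma theta_in_eta_span:
  assumes "(S, u) \<in> admissible l"
  shows "theta S u \<in> eta_span l"
  unfolding theta_eq_sum_eta[OF assms]
  using odd_peak_comp_in_odd_vcomps[OF assms]
  by (intro fs.subspace_sum fs.subspace_scale subspace_eta_span eta_in_eta_span) auto

lemma span_theta: "fs.span ((\<lambda>(S, u). theta S u) ` admissible l) = eta_span l"
proof
  show "fs.span ((\<lambda>(S, u). theta S u) ` admissible l) \<subseteq> eta_span l"
    using theta_in_eta_span by (intro fs.span_minimal subspace_eta_span) auto
  show "eta_span l \<subseteq> fs.span ((\<lambda>(S, u). theta S u) ` admissible l)"
  proof (rule eta_span_subsetI[OF fs.subspace_span])
    fix K assume odd: "K \<in> odd_vcomps l"
    have "(S, cw K) \<in> admissible l" if "S \<subseteq> Pk (tilde K)" for S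
      using odd admissible_subset[OF _ that] by (simp add: admissible_eq)
    then show "eta K \<in> fs.span ((\<lambda>(S, u). theta S u) ` admissible l)"
      unfolding eta_eq_sum_theta[OF odd]
      by (intro fs.span_sum fs.span_scale fs.span_base) force
  qed
qed

lemma eta_dual_coordinate_theta:
  assumes "(S, u) \<in> admissible l" "(T, v) \<in> admissible l"
    and linear: "Vector_Spaces.linear scl (*) \<phi>"
    and dual: "\<And>L. L \<in> odd_vcomps l \<Longrightarrow> \<phi> (eta L) = (if L = odd_peak_comp T v then 1 else 0)"
  shows "\<phi> (theta S u) = (if T \<subseteq> S \<and> u = v then (- 1) ^ card T else 0)"
proof -
  interpret Vector_Spaces.linear scl "(*)" \<phi>
    by (fact linear)
  have "odd_peak_comp R u = odd_peak_comp T v \<longleftrightarrow> R = T \<and> u = v" if "R \<subseteq> S" for R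
    using cw_odd_peak_comp[OF assms(1) that] Pk_tilde_odd_peak_comp[OF assms(1) that]
      cw_odd_peak_comp[OF assms(2) order_refl] Pk_tilde_odd_peak_comp[OF assms(2) order_refl]
    by metis
  then have "\<phi> (theta S u) = (\<Sum>R\<in>Pow S. (- 1) ^ card R * (if R = T \<and> u = v then 1 else 0))"
    unfolding theta_eq_sum_eta[OF assms(1)] sum scale
    using odd_peak_comp_in_odd_vcomps[OF assms(1)] dual by (intro sum.cong) auto
  also have "\<dots> = (\<Sum>R\<in>Pow S. if R = T then (if u = v then (- 1) ^ card T else 0) else 0)"
    by (intro sum.cong) auto
  also have "\<dots> = (if T \<subseteq> S \<and> u = v then (- 1) ^ card T else 0)"
    using admissible_finite[OF assms(1)] by simp
  finally show ?thesis .
qed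

lemma ex_triangular_family_theta:
  "\<exists>coord. triangular_family scl (admissible l) (\<lambda>(S, u). theta S u) coord (\<lambda>(S, u). card S)"
proof -
  have "\<exists>\<phi>. Vector_Spaces.linear scl (*) \<phi> \<and>
      (\<forall>L\<in>odd_vcomps l. \<phi> (eta L) = (if L = K then 1 else 0))" if "K \<in> odd_vcomps l" for K
    by (rule fs.ex_dual_functional[OF inj_on_eta independent_eta that])
  then obtain \<phi> where linear: "\<And>K. K \<in> odd_vcomps l \<Longrightarrow> Vector_Spaces.linear scl (*) (\<phi> K)"
    and dual: "\<And>K L. K \<in> odd_vcomps l \<Longrightarrow> L \<in> odd_vcomps l \<Longrightarrow>
      \<phi> K (eta L) = (if L = K then 1 else 0)"
    by metis
  let ?coord = "\<lambda>(T, v). \<phi> (odd_peak_comp T v)"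
  have odd: "odd_peak_comp T v \<in> odd_vcomps l" if "(T, v) \<in> admissible l" for T v
    by (rule odd_peak_comp_in_odd_vcomps[OF that order_refl])
  have theta: "\<phi> (odd_peak_comp T v) (theta S u) = (if T \<subseteq> S \<and> u = v then (- 1) ^ card T else 0)"
    if "(T, v) \<in> admissible l" "(S, u) \<in> admissible l" for S u T v
    using eta_dual_coordinate_theta[OF that(2,1)] linear dual odd[OF that(1)] by blast
  have "triangular_family scl (admissible l) (\<lambda>(S, u). theta S u) ?coord (\<lambda>(S, u). card S)"
  proof (intro triangular_family.intro triangular_family_axioms.intro fs.vector_space_axioms)
    fix x assume "x \<in> admissible l"
    then obtain T v where x_eq: "x = (T, v)" and adm_T: "(T, v) \<in> admissible l"
      by (cases x) auto
    show "Vector_Spaces.linear scl (*) (?coord x)"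
      using linear[OF odd[OF adm_T]] by (simp add: x_eq)
    show "?coord x (case x of (S, u) \<Rightarrow> theta S u) \<noteq> 0"
      by (simp add: x_eq theta[OF adm_T adm_T])
    fix y assume "y \<in> admissible l" and nonzero: "?coord x (case y of (S, u) \<Rightarrow> theta S u) \<noteq> 0"
    then obtain S u where y_eq: "y = (S, u)" and adm_S: "(S, u) \<in> admissible l"
      by (cases y) auto
    have "T \<subseteq> S" "u = v"
      using nonzero by (simp_all add: x_eq y_eq theta[OF adm_T adm_S] split: if_splits)
    then show "x = y \<or> (case x of (S, u) \<Rightarrow> card S) < (case y of (S, u) \<Rightarrow> card S)"
      using psubset_card_mono[OF admissible_finite[OF adm_S], of T] by (auto simp: x_eq y_eq)
  qed
  then show ?thesis
    by blast
qed

lemma inj_on_theta: "inj_on (\<lambda>(S, u). theta S u) (admissible l)"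
  using ex_triangular_family_theta triangular_family.inj_on_family by blast

lemma independent_theta: "fs.independent ((\<lambda>(S, u). theta S u) ` admissible l)"
  using ex_triangular_family_theta triangular_family.independent_family by blast

theorem theorem6p7:
  fixes l :: nat
  assumes "l \<ge> 1"
  shows "inj_on (\<lambda>(S, u). theta S u) (admissible l) \<and>
     fs.independent ((\<lambda>(S, u). theta S u) ` admissible l) \<and>
     fs.span ((\<lambda>(S, u). theta S u) ` admissible l) = O_infty l \<and>
     (\<forall>I\<in>vcomps l. (\<forall>i\<in>set I. odd (wt i)) \<longrightarrow>
        eta I = (\<Sum>S\<in>Pow (Pk (tilde I)). scl ((- 1) ^ card S) (theta S (cw I)))) \<and>
     (\<forall>(S, u)\<in>admissible l.
        theta S u = (\<Sum>T\<in>Pow S. scl ((- 1) ^ card T) (eta (odd_comp (peak_comp T u)))))"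
proof (intro conjI ballI impI)
  show "inj_on (\<lambda>(S, u). theta S u) (admissible l)"
    by (rule inj_on_theta)
  show "fs.independent ((\<lambda>(S, u). theta S u) ` admissible l)"
    by (rule independent_theta)
  show "fs.span ((\<lambda>(S, u). theta S u) ` admissible l) = O_infty l"
    by (simp only: span_theta O_infty_eq_eta_span)
next
  fix I assume "I \<in> vcomps l" "\<forall>i\<in>set I. odd (wt i)"
  then have "I \<in> odd_vcomps l"
    by (simp add: odd_vcomps_def)
  then show "eta I = (\<Sum>S\<in>Pow (Pk (tilde I)). scl ((- 1) ^ card S) (theta S (cw I)))"
    by (rule eta_eq_sum_theta)
next
  fix x assume "x \<in> admissible l"
  then show "case x of (S, u) \<Rightarrow>
      theta S u = (\<Sum>T\<in>Pow S. scl ((- 1) ^ card T) (eta (odd_comp (peak_comp T u))))"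
    using theta_eq_sum_eta by (cases x) blast
qed

end
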